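(* Let $x,y\in\mathbb{C}^\ast\setminus(-\infty,1]$ and $\lambda,\mu,\alpha,\beta,\gamma\in\mathbb{C}$. Then $$Q_{\gamma-\lambda-\mu}^{(\alpha+2\lambda+\mu,\beta+\mu)}(x)\,Q_{\gamma-\lambda-\mu}^{(\alpha+2\lambda+\mu,\beta+\mu)}(y)=\frac{\Gamma(\alpha+\gamma+\lambda+1)\Gamma(\beta+\gamma-\lambda+1)}{2\,\Gamma(\alpha+\beta+2\gamma+2)}\left(\frac{2}{x+y}\right)^{\alpha+\beta+\gamma+\lambda+\mu+1}\sum_{k=0}^\infty\frac{(\gamma-\lambda-\mu+1)_k(\alpha+\beta+\gamma+\lambda+\mu+1)_k}{(\alpha+\beta+2\gamma+2)_k\,k!}\left(\frac{2}{x+y}\right)^k Q_{\gamma-\lambda-\mu+k}^{(\alpha+2\lambda+\mu,\beta+\mu)}\!\left(\frac{1+xy}{x+y}\right).$$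
   Context: $\mathbb{C}^\ast=\mathbb{C}\setminus\{0\}$; $(a)_k=\Gamma(a+k)/\Gamma(a)$ is the Pochhammer symbol. The regularized Gauss hypergeometric function is $\mathbf{F}(a,b;c;z)=\sum_{n\ge0}\frac{(a)_n(b)_n}{\Gamma(c+n)}\frac{z^n}{n!}$, continued analytically to $\mathbb{C}\setminus[1,\infty)$. The Jacobi function of the second kind is, for $z\in\mathbb{C}\setminus(-\infty,1]$, $Q_\gamma^{(\alpha,\beta)}(z)=\frac{2^{\alpha+\beta+\gamma}\Gamma(\alpha+\gamma+1)\Gamma(\beta+\gamma+1)}{(z-1)^{\alpha+\gamma+1}(z+1)^\beta}\mathbf{F}\big(\gamma+1,\alpha+\gamma+1;\alpha+\beta+2\gamma+2;\frac{2}{1-z}\big)$, with powers positive for $z>1$ and real exponents. Convention: the basic range is $x,y>1$ real; for complex values multivalued expressions are continued analytically from that range. Parameters and variables are assumed such that all Gamma factors and functions are defined ($\alpha+\gamma+\lambda,\ \beta+\gamma-\lambda\notin\{-1,-2,\dots\}$, $x+y\neq0$, etc.) and such that the series converges. *)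

theory Defs
  imports "HOL-Analysis.Analysis"
begin

definition hyp2F1_reg_series :: "complex \<Rightarrow> complex \<Rightarrow> complex \<Rightarrow> complex \<Rightarrow> complex" where
  "hyp2F1_reg_series a b c z =
     (\<Sum>n. pochhammer a n * pochhammer b n * rGamma (c + of_nat n) * z ^ n / fact n)"

text \<open>
  The regularized Gauss hypergeometric function: the analytic continuation of the series from
  the unit disc to the complex plane cut along $[1,\infty)$.  The chosen function is uniquely
  determined on the cut plane by the identity theorem; its values on the cut itself are arbitrary.
\<close>

definition hyp2F1_reg :: "complex \<Rightarrow> complex \<Rightarrow> complex \<Rightarrow> complex \<Rightarrow> complex" where
  "hyp2F1_reg a b c =
     (SOME F. F holomorphic_on (- complex_of_real ` {1..}) \<and>
              (\<forall>z\<in>ball 0 1. F z = hyp2F1_reg_series a b c z))"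

text \<open>
  The Jacobi function of the second kind, meant for \<open>z\<close> outside $(-\infty,1]$: there both
  \<open>z - 1\<close> and \<open>z + 1\<close> avoid the branch cut of the principal power \<open>powr\<close>, and
  \<open>2 / (1 - z)\<close> avoids $[1,\infty)$.
\<close>

definition jacobi_Q :: "complex \<Rightarrow> complex \<Rightarrow> complex \<Rightarrow> complex \<Rightarrow> complex" where
  "jacobi_Q \<alpha> \<beta> \<gamma> z =
     2 powr (\<alpha> + \<beta> + \<gamma>) * Gamma (\<alpha> + \<gamma> + 1) * Gamma (\<beta> + \<gamma> + 1) /
       ((z - 1) powr (\<alpha> + \<gamma> + 1) * (z + 1) powr \<beta>) *
     hyp2F1_reg (\<gamma> + 1) (\<alpha> + \<gamma> + 1) (\<alpha> + \<beta> + 2 * \<gamma> + 2) (2 / (1 - z))"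

definition cut_plane :: "complex set" where
  "cut_plane = - complex_of_real ` {..1}"

definition basic_range :: "(complex \<times> complex) set" where
  "basic_range = complex_of_real ` {1<..} \<times> complex_of_real ` {1<..}"

definition var_domain :: "(complex \<times> complex) set" where
  "var_domain = {(x, y). x \<in> cut_plane \<and> y \<in> cut_plane \<and> x + y \<noteq> 0}"

text \<open>
  Holomorphy in two complex variables: the derivative exists and is complex linear.
\<close>

definition holomorphic2_on :: "(complex \<times> complex \<Rightarrow> complex) \<Rightarrow> (complex \<times> complex) set \<Rightarrow> bool" where
  "holomorphic2_on f U \<longleftrightarrow>
     (\<forall>p\<in>U. \<exists>a b. (f has_derivative (\<lambda>(h, k). a * h + b * k)) (at p))"

text \<open>
  \<open>continuation_on U f g\<close>: on the connected open set \<open>U\<close> of admissible variables containing the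
  basic range $x, y > 1$, the function \<open>g\<close> is the (unique) analytic continuation of the values
  that the expression \<open>f\<close> takes on the basic range.  This is how a multivalued expression is
  evaluated at complex arguments: \<open>f\<close> is written with principal branches, which is the intended
  meaning only on the basic range, where all bases of powers are positive.  Different sets \<open>U\<close>
  through the same point account for the different paths of continuation.
\<close>

definition continuation_on ::
  "(complex \<times> complex) set \<Rightarrow> (complex \<Rightarrow> complex \<Rightarrow> complex) \<Rightarrow>
   (complex \<times> complex \<Rightarrow> complex) \<Rightarrow> bool" where
  "continuation_on U f g \<longleftrightarrow>
     open U \<and> connected U \<and> basic_range \<subseteq> U \<and> U \<subseteq> var_domain \<and>
     holomorphic2_on g U \<and> (\<forall>(x, y)\<in>basic_range. g (x, y) = f x y)"

end

theory Submission
  imports Defs "HOL-Complex_Analysis.Complex_Analysis"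
begin

text \<open>
  With $X = 2/(1-x)$, $Y = 2/(1-y)$ the formula is the Burchnall--Chaundy expansion of
  $F(a,b;c;X)\,F(a,b;c;Y)$ in powers of $XY$ with coefficients
  $F(a+k,b+k;c+2k;X+Y-XY)$, where $1 - (X+Y-XY) = (1-X)(1-Y)$.  All functions are lifted to the
  logarithmic variable $z = \ln(1-X)$: there $F$ extends holomorphically to $|{\rm Im}\,z| < 2\pi$,
  so that the coefficients, evaluated at a sum of two points of $|{\rm Im}\,z| < \pi$, are
  single-valued and agree with every admissible continuation.

  Subtracting finitely many terms of the expansion and applying the hypergeometric operator
  telescopes, which shows that the remainder vanishes to high order as $X \to 0$.  Fixing $z_1 + z_2$
  and varying $XY$ turns the expansion into a genuine power series.  It converges at the given
  point, so it is holomorphic in the disc through this point; the segment from $0$ to the point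
  lifts to the strip, analytic continuation along it and Abel's limit theorem give the identity,
  without any estimate of the region of convergence.
\<close>

subsection \<open>Convergence of Frobenius series\<close>

text \<open>The argument z = (1 + x y)/(x + y) explains the logarithmic variable: z - 1 = (x - 1)(y
  - 1)/(x + y) and z + 1 = (x + 1)(y + 1)/(x + y), so ln((z + 1)/(z - 1)) is, for x, y > 1, the sum
  of the same logarithms of x and y. For complex x, y this sum leaves the range of the principal
  logarithm, and powers of x + y wind around x + y = 0; that is the obstacle on the right-hand side.
  The width 2 pi just accommodates such sums. It cannot be enlarged in general: at 2 pi i the
  variable X returns to 0 on another sheet, where F is usually singular. The high order of vanishing
  comes from the exponents 0 and 1 - c of the equation at X = 0. As c is not a non-positive integer,
  no positive integer is an exponent, and the exponent 0 is excluded because the remainder is zero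
  at X = 0. Summability is assumed at one point only, possibly on the boundary of the disc of
  convergence in XY. The radius to that point must lift to a path on which both factors on the left
  are defined; this comes down to a segment of values of cosh missing a ray.\<close>

text \<open>A majorant argument. With coefficients weighted by s^n for some s between q and the
  radius, the recursion bounds the next weighted coefficient by a constant times the partial sum
  \<open>E n\<close> over |A_0 + n|. Since |A_0 + n| tends to infinity, \<open>E\<close> grows
  slower than any geometric sequence.\<close>

lemma frobenius_conv_radius:
  fixes H A B :: "complex fps" and r :: ereal
  assumes ode: "fps_X * fps_deriv (fps_deriv H) + A * fps_deriv H + B * H = 0"
    and rA: "fps_conv_radius A \<ge> r" and rB: "fps_conv_radius B \<ge> r"
    and nz: "\<And>n. fps_nth A 0 + of_nat n \<noteq> 0"
  shows "fps_conv_radius H \<ge> r"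
  unfolding fps_conv_radius_def
proof (rule conv_radius_geI_ex')
  fix q :: real assume q: "q > 0" "ereal q < r"
  obtain s where s: "q < s" "ereal s < r"
    using ereal_dense2[OF q(2)] q(1) by auto
  have bnd: "\<exists>M. \<forall>n. norm (fps_nth F n) * s ^ n \<le> M" if "fps_conv_radius F \<ge> r" for F :: "complex fps"
  proof -
    have "summable (\<lambda>n. fps_nth F n * of_real s ^ n)"
      by (rule summable_in_conv_radius) (use that s q in \<open>auto simp: fps_conv_radius_def less_le_trans\<close>)
    then have "Bseq (\<lambda>n. fps_nth F n * of_real s ^ n)"
      by (intro convergent_imp_Bseq) (auto simp: convergent_def dest: summable_LIMSEQ_zero)
    then obtain M where "\<And>n. norm (fps_nth F n * of_real s ^ n) \<le> M"
      by (auto elim!: BseqE)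
    then show ?thesis using s q by (auto simp: norm_mult norm_power intro!: exI[of _ M])
  qed
  obtain M1 where M1: "\<And>n. norm (fps_nth A n) * s ^ n \<le> M1" using bnd[OF rA] by blast
  obtain M2 where M2: "\<And>n. norm (fps_nth B n) * s ^ n \<le> M2" using bnd[OF rB] by blast
  define M where "M = max M1 M2"
  have MA: "norm (fps_nth A n) * s ^ n \<le> M" and MB: "norm (fps_nth B n) * s ^ n \<le> M" for n
    using M1[of n] M2[of n] by (auto simp: M_def)
  have M0: "M \<ge> 0" using MA[of 0] norm_ge_zero[of "fps_nth A 0"] by (simp del: norm_ge_zero)
  define h where "h n = norm (fps_nth H n) * s ^ n" for n
  define E where "E n = (\<Sum>j\<le>n. h j)" for n
  have s0: "s > 0" using s q by simp
  have h0: "h n \<ge> 0" for n using s0 by (simp add: h_def)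
  have E0: "E n \<ge> 0" for n using h0 by (simp add: E_def sum_nonneg)
  have step: "norm (fps_nth A 0 + of_nat n) * h (Suc n) \<le> M * (1 + s) * E n" for n
  proof -
    let ?a = "\<lambda>i. fps_nth A i * (of_nat (Suc (n - i)) * fps_nth H (Suc (n - i)))"
    have "fps_nth (fps_X * fps_deriv (fps_deriv H)) n = of_nat n * (of_nat (Suc n) * fps_nth H (Suc n))"
      by (cases n) simp_all
    moreover have "fps_nth (fps_X * fps_deriv (fps_deriv H) + A * fps_deriv H + B * H) n = 0"
      using ode by simp
    ultimately have "of_nat n * (of_nat (Suc n) * fps_nth H (Suc n)) + (\<Sum>i=0..n. ?a i) + (\<Sum>i=0..n. fps_nth B i * fps_nth H (n - i)) = 0"
      by (simp add: fps_mult_nth del: fps_X_mult_nth)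
    \<comment> \<open>The summand i = 0 still contains the unknown coefficient. Split off, it
      combines with the contribution of the second derivative to the indicial factor (n + 1)(A_0 +
      n).\<close>
    moreover have "(\<Sum>i=0..n. ?a i) = ?a 0 + (\<Sum>i=1..n. ?a i)"
      by (simp add: sum.atLeast_Suc_atMost)
    ultimately have eq: "(of_nat (Suc n) * (fps_nth A 0 + of_nat n)) * fps_nth H (Suc n)
        = - ((\<Sum>i=1..n. ?a i) + (\<Sum>i=0..n. fps_nth B i * fps_nth H (n - i)))"
      by (simp add: algebra_simps eq_neg_iff_add_eq_0)
    have "(\<Sum>i=1..n. norm (?a i) * s ^ Suc n) \<le> (\<Sum>i=1..n. M * (real (Suc n) * h (Suc (n - i))))"
    proof (rule sum_mono)
      fix i assume i: "i \<in> {1..n}"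
      have "norm (?a i) * s ^ Suc n = (norm (fps_nth A i) * s ^ i) * (real (Suc (n - i)) * h (Suc (n - i)))"
      proof -
        have "s ^ Suc n = s ^ i * s ^ Suc (n - i)" using i by (simp flip: power_add)
        then show ?thesis by (simp add: norm_mult h_def del: of_nat_Suc power_Suc)
      qed
      also have "\<dots> \<le> M * (real (Suc n) * h (Suc (n - i)))"
        by (intro mult_mono MA) (use M0 h0 in auto)
      finally show "norm (?a i) * s ^ Suc n \<le> M * (real (Suc n) * h (Suc (n - i)))" .
    qed
    also have "(\<Sum>i=1..n. M * (real (Suc n) * h (Suc (n - i)))) = M * real (Suc n) * (\<Sum>i=1..n. h (Suc (n - i)))"
      by (simp add: sum_distrib_left mult.assoc)
    also have "(\<Sum>i=1..n. h (Suc (n - i))) = (\<Sum>j=1..n. h j)"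
      by (rule sum.reindex_bij_witness[of _ "\<lambda>j. Suc n - j" "\<lambda>i. Suc n - i"]) (auto simp: Suc_diff_le)
    finally have S1: "(\<Sum>i=1..n. norm (?a i) * s ^ Suc n) \<le> M * real (Suc n) * (\<Sum>j=1..n. h j)" .
    have S1': "(\<Sum>j=1..n. h j) \<le> E n" unfolding E_def by (rule sum_mono2) (use h0 in auto)
    have S1'': "(\<Sum>i=1..n. norm (?a i) * s ^ Suc n) \<le> M * real (Suc n) * E n"
      by (rule order.trans[OF S1 mult_left_mono[OF S1']]) (use M0 in simp)
    have "(\<Sum>i=0..n. norm (fps_nth B i * fps_nth H (n - i)) * s ^ Suc n) \<le> (\<Sum>i=0..n. M * (s * h (n - i)))"
    proof (rule sum_mono)
      fix i assume i: "i \<in> {0..n}"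
      have "norm (fps_nth B i * fps_nth H (n - i)) * s ^ Suc n = (norm (fps_nth B i) * s ^ i) * (s * h (n - i))"
      proof -
        have "s ^ Suc n = s * (s ^ i * s ^ (n - i))" using i by (simp flip: power_add)
        then show ?thesis by (simp add: norm_mult h_def del: of_nat_Suc power_Suc)
      qed
      also have "\<dots> \<le> M * (s * h (n - i))"
        by (intro mult_mono MB) (use M0 h0 s0 in auto)
      finally show "norm (fps_nth B i * fps_nth H (n - i)) * s ^ Suc n \<le> M * (s * h (n - i))" .
    qed
    also have "(\<Sum>i=0..n. M * (s * h (n - i))) = M * s * (\<Sum>i=0..n. h (n - i))"
      by (simp add: sum_distrib_left mult.assoc)
    also have "(\<Sum>i=0..n. h (n - i)) = E n"
      unfolding E_def by (rule sum.reindex_bij_witness[of _ "\<lambda>j. n - j" "\<lambda>i. n - i"]) auto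
    also have "M * s * E n \<le> real (Suc n) * (M * s * E n)"
      using mult_right_mono[of 1 "real (Suc n)" "M * s * E n"] M0 s0 E0[of n] by simp
    finally have S2: "(\<Sum>i=0..n. norm (fps_nth B i * fps_nth H (n - i)) * s ^ Suc n) \<le> real (Suc n) * (M * s * E n)" .
    have "real (Suc n) * (norm (fps_nth A 0 + of_nat n) * h (Suc n))
        = norm ((of_nat (Suc n) * (fps_nth A 0 + of_nat n)) * fps_nth H (Suc n)) * s ^ Suc n"
      by (simp add: norm_mult h_def del: of_nat_Suc)
    also have "\<dots> \<le> ((\<Sum>i=1..n. norm (?a i)) + (\<Sum>i=0..n. norm (fps_nth B i * fps_nth H (n - i)))) * s ^ Suc n"
      unfolding eq norm_minus_cancel
      by (intro mult_right_mono order.trans[OF norm_triangle_ineq] add_mono norm_sum) (use s0 in auto)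
    also have "\<dots> = (\<Sum>i=1..n. norm (?a i) * s ^ Suc n) + (\<Sum>i=0..n. norm (fps_nth B i * fps_nth H (n - i)) * s ^ Suc n)"
      by (simp add: sum_distrib_right distrib_right)
    also have "\<dots> \<le> M * real (Suc n) * E n + real (Suc n) * (M * s * E n)"
      by (rule add_mono[OF S1'' S2])
    also have "\<dots> = real (Suc n) * (M * (1 + s) * E n)"
      by (simp add: algebra_simps del: of_nat_Suc)
    finally have "real (Suc n) * (norm (fps_nth A 0 + of_nat n) * h (Suc n)) \<le> real (Suc n) * (M * (1 + s) * E n)" .
    then show ?thesis by (subst (asm) mult_le_cancel_left_pos) auto
  qed
  \<comment> \<open>The midpoint of q/s and 1: the quotients of the majorant \<open>g\<close> are
    bounded by a sequence tending to q/s, hence eventually by \<open>c\<close>.\<close>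
  define c where "c = (1 + q / s) / 2"
  have c: "c < 1" "q / s < c" using s q s0 by (auto simp: c_def field_simps)
  have "filterlim (\<lambda>n. norm (fps_nth A 0 + of_nat n)) at_top sequentially"
    by (rule filterlim_compose[OF filterlim_norm_at_top])
       (intro tendsto_add_filterlim_at_infinity[OF tendsto_const] tendsto_of_nat)
  then have "((\<lambda>n. (1 + M * (1 + s) / norm (fps_nth A 0 + of_nat n)) * (q / s)) \<longlongrightarrow> (1 + 0) * (q / s)) sequentially"
    by (intro tendsto_intros real_tendsto_divide_at_top[of _ "M * (1 + s)"])
  then have "eventually (\<lambda>n. (1 + M * (1 + s) / norm (fps_nth A 0 + of_nat n)) * (q / s) < c) sequentially"
    by (rule order_tendstoD(2)) (use c in simp)
  then obtain N where N: "\<And>n. n \<ge> N \<Longrightarrow> (1 + M * (1 + s) / norm (fps_nth A 0 + of_nat n)) * (q / s) < c"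
    by (auto simp: eventually_sequentially)
  define g where "g n = E n * (q / s) ^ n" for n
  have g0: "g n \<ge> 0" for n using E0[of n] q s0 by (simp add: g_def)
  have "summable g"
  proof (rule summable_ratio_test[OF c(1)])
    fix n assume n: "n \<ge> N"
    have "norm (fps_nth A 0 + of_nat n) > 0" using nz[of n] by simp
    then have "h (Suc n) \<le> M * (1 + s) / norm (fps_nth A 0 + of_nat n) * E n"
      using step[of n] by (simp add: field_simps)
    then have "E (Suc n) \<le> (1 + M * (1 + s) / norm (fps_nth A 0 + of_nat n)) * E n"
      by (simp add: E_def algebra_simps)
    then have "g (Suc n) \<le> (1 + M * (1 + s) / norm (fps_nth A 0 + of_nat n)) * E n * (q / s) ^ Suc n"
      unfolding g_def using q s0 by (intro mult_right_mono) auto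
    also have "\<dots> = ((1 + M * (1 + s) / norm (fps_nth A 0 + of_nat n)) * (q / s)) * g n"
      by (simp add: g_def)
    also have "\<dots> \<le> c * g n"
      using N[OF n] g0[of n] by (intro mult_right_mono) auto
    finally show "norm (g (Suc n)) \<le> c * norm (g n)" using g0 by simp
  qed
  then show "summable (\<lambda>n. fps_nth H n * of_real q ^ n)"
  proof (intro summable_comparison_test[OF _ \<open>summable g\<close>] exI[of _ 0] allI impI)
    fix n
    have "norm (fps_nth H n * of_real q ^ n) = h n * (q / s) ^ n"
      using s0 q by (simp add: h_def norm_mult norm_power power_divide)
    also have "\<dots> \<le> g n" unfolding g_def
      by (intro mult_right_mono) (use q s0 h0 in \<open>auto simp: E_def intro: member_le_sum\<close>)
    finally show "norm (fps_nth H n * of_real q ^ n) \<le> g n" .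
  qed
qed

subsection \<open>The hypergeometric series and its lift to a strip\<close>

text \<open>Normalised to constant term 1; the factor \<open>rGamma c\<close> of the regularized
  function is restored only in \<open>hyp2F1_reg_series_eq\<close>.\<close>

definition hyp_fps :: "complex \<Rightarrow> complex \<Rightarrow> complex \<Rightarrow> complex fps" where
  "hyp_fps a b c = Abs_fps (\<lambda>n. pochhammer a n * pochhammer b n / (pochhammer c n * fact n))"

section \<open>Coefficient identities for the hypergeometric series\<close>

lemma add_of_nat_nonpos_Ints_neq:
  assumes "(c::complex) \<notin> \<int>\<^sub>\<le>\<^sub>0"
  shows "c + of_nat n \<noteq> 0" and "of_nat n + c \<noteq> 0"
  using assms plus_of_nat_eq_0_imp[of c n] by (auto simp: add.commute)

lemma add_of_nat_not_nonpos_Ints: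
  assumes "(c::complex) \<notin> \<int>\<^sub>\<le>\<^sub>0"
  shows "c + of_nat n \<notin> \<int>\<^sub>\<le>\<^sub>0"
proof
  assume "c + of_nat n \<in> \<int>\<^sub>\<le>\<^sub>0"
  then obtain m where "c + of_nat n = - of_nat m" by (elim nonpos_Ints_cases')
  then have "c + of_nat (n + m) = 0" by (simp add: eq_neg_iff_add_eq_0 add.assoc)
  with add_of_nat_nonpos_Ints_neq(1)[OF assms] show False by blast
qed

lemma pochhammer_not_nonpos_Ints_neq:
  assumes "(c::complex) \<notin> \<int>\<^sub>\<le>\<^sub>0"
  shows "pochhammer c n \<noteq> 0"
proof
  assume "pochhammer c n = 0"
  then obtain k where "c = - of_nat k" by (auto simp: pochhammer_eq_0_iff)
  with add_of_nat_nonpos_Ints_neq(1)[OF assms, of k] show False by simp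
qed

lemma hyp_fps_nth_0 [simp]: "fps_nth (hyp_fps a b c) 0 = 1"
  by (simp add: hyp_fps_def)

lemma hyp_fps_rec:
  assumes "c \<notin> \<int>\<^sub>\<le>\<^sub>0"
  shows "(c + of_nat n) * (1 + of_nat n) * fps_nth (hyp_fps a b c) (Suc n)
    = (a + of_nat n) * (b + of_nat n) * fps_nth (hyp_fps a b c) n"
proof -
  have "c + of_nat n \<noteq> 0" "pochhammer c n \<noteq> 0" "(1 + of_nat n :: complex) \<noteq> 0"
    using assms by (auto simp: add_of_nat_nonpos_Ints_neq pochhammer_not_nonpos_Ints_neq
        simp flip: of_nat_Suc)
  moreover have "fps_nth (hyp_fps a b c) (Suc n) =
      fps_nth (hyp_fps a b c) n * ((a + of_nat n) * (b + of_nat n)) / ((c + of_nat n) * (1 + of_nat n))"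
    by (simp add: hyp_fps_def pochhammer_Suc mult_ac)
  ultimately show ?thesis by (simp add: mult_ac)
qed

lemma hyp_fps_ode:
  assumes "c \<notin> \<int>\<^sub>\<le>\<^sub>0"
  shows "fps_X * ((1 - fps_X) * fps_deriv (fps_deriv (hyp_fps a b c)))
    + (fps_const c - fps_const (a + b + 1) * fps_X) * fps_deriv (hyp_fps a b c)
    - fps_const (a * b) * hyp_fps a b c = 0" (is "?L = 0")
proof -
  define H where "H = hyp_fps a b c"
  have "fps_X * fps_deriv (fps_deriv H) - fps_X * (fps_X * fps_deriv (fps_deriv H))
      + (fps_const c * fps_deriv H - fps_const (a + b + 1) * (fps_X * fps_deriv H))
      - fps_const (a * b) * H = 0" (is "?R = 0")
  proof (rule fps_ext)
    fix n
    show "fps_nth ?R n = fps_nth 0 n"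
    proof (cases n)
      case 0
      then show ?thesis using hyp_fps_rec[OF assms, of 0 a b]
        by (simp add: H_def)
    next
      case (Suc m)
      then show ?thesis using hyp_fps_rec[OF assms, of n a b] unfolding H_def[symmetric]
        by (cases m) (simp_all add: algebra_simps)
    qed
  qed
  then show ?thesis by (simp add: H_def algebra_simps)
qed

text \<open>This raises (a, b, c) by (1, 1, 2), exactly the step between consecutive functions of
  the expansion, and c - a - b is invariant under it. It is the relation that makes the later sum
  telescope.\<close>

lemma hyp_fps_contiguous:
  assumes "c \<notin> \<int>\<^sub>\<le>\<^sub>0"
  shows "(1 - fps_X) * fps_deriv (fps_deriv (hyp_fps a b c))
    + fps_const (c - a - b - 1) * fps_deriv (hyp_fps a b c)
    = fps_const (a * b * (c - a) * (c - b) / (c * (c + 1))) * hyp_fps (a + 1) (b + 1) (c + 2)"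
proof -
  define H where "H = hyp_fps a b c"
  define K where "K = hyp_fps (a + 1) (b + 1) (c + 2)"
  have c0: "c \<noteq> 0" "c + 1 \<noteq> 0"
    using add_of_nat_nonpos_Ints_neq(1)[OF assms, of 0] add_of_nat_nonpos_Ints_neq(1)[OF assms, of 1] by auto
  define k where "k = a * b / (c * (c + 1))"
  have H1: "(1 + of_nat n) * fps_nth H (Suc n) = k * (c + 1 + of_nat n) * fps_nth K n" for n
  proof -
    have nz: "pochhammer (c + 2) n \<noteq> 0" "pochhammer (c + 1) n \<noteq> 0" "(1 + of_nat n :: complex) \<noteq> 0"
      using pochhammer_not_nonpos_Ints_neq[OF add_of_nat_not_nonpos_Ints[OF assms, of 2], of n]
        pochhammer_not_nonpos_Ints_neq[OF add_of_nat_not_nonpos_Ints[OF assms, of 1], of n]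
        of_nat_neq_0[of n, where 'a = complex] by simp_all
    have p: "(c + 1) * pochhammer (c + 2) n = pochhammer (c + 1) n * (c + 1 + of_nat n)"
      using pochhammer_rec[of "c + 1" n] pochhammer_Suc[of "c + 1" n] by (simp add: add.assoc)
    have "(1 + of_nat n) * fps_nth H (Suc n)
      = a * b / c * (pochhammer (a + 1) n * pochhammer (b + 1) n / fact n) / pochhammer (c + 1) n"
      using nz c0 by (simp add: H_def hyp_fps_def pochhammer_rec divide_simps)
    also have "1 / pochhammer (c + 1) n = (c + 1 + of_nat n) / ((c + 1) * pochhammer (c + 2) n)"
      using nz c0 p add_of_nat_nonpos_Ints_neq(1)[OF assms, of "Suc n"]
      by (simp add: divide_simps add_ac)
    then have "a * b / c * (pochhammer (a + 1) n * pochhammer (b + 1) n / fact n) / pochhammer (c + 1) n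
      = a * b / c * (pochhammer (a + 1) n * pochhammer (b + 1) n / fact n) * ((c + 1 + of_nat n) / ((c + 1) * pochhammer (c + 2) n))"
      by (metis divide_inverse_commute inverse_eq_divide mult.commute)
    also have "\<dots> = k * (c + 1 + of_nat n) * fps_nth K n"
      using nz c0 by (simp add: k_def K_def hyp_fps_def mult_ac)
    finally show ?thesis .
  qed
  have "fps_deriv (fps_deriv H) - fps_X * fps_deriv (fps_deriv H)
      + fps_const (c - a - b - 1) * fps_deriv H = fps_const (k * (c - a) * (c - b)) * K" (is "?L = ?R")
  proof (rule fps_ext)
    fix n
    have "(c + 1 + of_nat n) * ((1 + of_nat n) * (2 + of_nat n) * fps_nth H (Suc (Suc n)))
      = (1 + of_nat n) * ((c + of_nat (Suc n)) * (1 + of_nat (Suc n)) * fps_nth H (Suc (Suc n)))"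
      by (simp add: algebra_simps)
    also have "\<dots> = (a + 1 + of_nat n) * (b + 1 + of_nat n) * ((1 + of_nat n) * fps_nth H (Suc n))"
      unfolding H_def hyp_fps_rec[OF assms] by (simp add: algebra_simps)
    also have "\<dots> = (c + 1 + of_nat n) * ((a + 1 + of_nat n) * (b + 1 + of_nat n) * (k * fps_nth K n))"
      unfolding H1 by (simp add: algebra_simps)
    finally have H2: "(1 + of_nat n) * (2 + of_nat n) * fps_nth H (Suc (Suc n))
      = (a + 1 + of_nat n) * (b + 1 + of_nat n) * (k * fps_nth K n)"
      using add_of_nat_nonpos_Ints_neq(1)[OF assms, of "Suc n"] by (simp add: add_ac)
    have "fps_nth ?L n = (1 + of_nat n) * (2 + of_nat n) * fps_nth H (Suc (Suc n))
        + (c - a - b - 1 - of_nat n) * ((1 + of_nat n) * fps_nth H (Suc n))"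
      by (cases n) (simp_all add: algebra_simps)
    \<comment> \<open>With m = n + 1 the remaining bracket is (a + m)(b + m) + (c - a - b - m)(c +
      m) = (c - a)(c - b), which no longer depends on n.\<close>
    also have "\<dots> = fps_nth ?R n"
      unfolding H1 H2 by (simp add: algebra_simps)
    finally show "fps_nth ?L n = fps_nth ?R n" .
  qed
  then show ?thesis
    by (simp add: H_def K_def k_def algebra_simps)
qed

text \<open>Multiplying the hypergeometric equation by the geometric series \<open>G\<close>, the
  inverse of 1 - X, brings it into Frobenius form with coefficients convergent in the unit disc.
  Only a lower bound can hold, since the series may terminate.\<close>

lemma hyp_fps_conv_radius:
  assumes "c \<notin> \<int>\<^sub>\<le>\<^sub>0"
  shows "fps_conv_radius (hyp_fps a b c) \<ge> 1"
proof (rule frobenius_conv_radius)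
  define G :: "complex fps" where "G = Abs_fps (\<lambda>_. 1)"
  have G: "(1 - fps_X) * G = 1"
    by (rule fps_ext) (simp add: G_def left_diff_distrib)
  have rG: "fps_conv_radius G \<ge> 1"
    unfolding G_def fps_conv_radius_def by (rule conv_radius_geI_ex') (simp add: one_ereal_def)
  define H where "H = hyp_fps a b c"
  define A where "A = G * (fps_const c - fps_const (a + b + 1) * fps_X)"
  define B where "B = - (fps_const (a * b) * G)"
  have "fps_X * fps_deriv (fps_deriv H) + A * fps_deriv H + B * H
    = fps_X * (((1 - fps_X) * G) * fps_deriv (fps_deriv H)) + A * fps_deriv H + B * H"
    by (simp add: G)
  also have "\<dots> = G * (fps_X * ((1 - fps_X) * fps_deriv (fps_deriv H))
    + (fps_const c - fps_const (a + b + 1) * fps_X) * fps_deriv H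
    - fps_const (a * b) * H)"
    unfolding A_def B_def by algebra
  also have "\<dots> = 0" using hyp_fps_ode[OF assms, of a b] by (simp add: H_def)
  finally show "fps_X * fps_deriv (fps_deriv (hyp_fps a b c)) + A * fps_deriv (hyp_fps a b c) + B * hyp_fps a b c = 0"
    by (simp add: H_def)
  have "fps_conv_radius (fps_const c - fps_const (a + b + 1) * fps_X) \<ge> 1"
    by (rule order.trans[OF _ fps_conv_radius_diff]) (simp add: fps_conv_radius_mult_ge)
  then show "fps_conv_radius A \<ge> 1"
    unfolding A_def by (intro fps_conv_radius_mult_ge rG) simp
  show "fps_conv_radius B \<ge> 1"
    unfolding B_def fps_conv_radius_uminus by (intro fps_conv_radius_mult_ge rG) simp
  show "fps_nth A 0 + of_nat n \<noteq> 0" for n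
    using add_of_nat_nonpos_Ints_neq(1)[OF assms] by (simp add: A_def G_def)
qed

text \<open>The Taylor series of a local regular solution solves the formal equation, so its radius
  is governed by the coefficients \<open>p\<close>, \<open>q\<close> and not by the disc on which
  \<open>h\<close> was given.\<close>

lemma frobenius_extension:
  fixes h p q :: "complex \<Rightarrow> complex"
  assumes h: "h holomorphic_on ball 0 e" and e: "e > 0"
    and p: "p holomorphic_on ball 0 1" and q: "q holomorphic_on ball 0 1"
    and ode: "\<And>u. u \<in> ball 0 e \<Longrightarrow> u * deriv (deriv h) u + p u * deriv h u + q u * h u = 0"
    and nz: "\<And>n. p 0 + of_nat n \<noteq> 0"
  obtains g where "g holomorphic_on ball 0 1" "eventually (\<lambda>u. g u = h u) (nhds 0)"
proof -
  define H P Q where "H = fps_expansion h 0" "P = fps_expansion p 0" "Q = fps_expansion q 0"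
  have [fps_expansion_intros]: "h has_fps_expansion H" "p has_fps_expansion P" "q has_fps_expansion Q"
    unfolding H_P_Q_def by (rule has_fps_expansion_fps_expansion[OF open_ball _ h]
        has_fps_expansion_fps_expansion[OF open_ball _ p] has_fps_expansion_fps_expansion[OF open_ball _ q];
        use e in simp)+
  have "(\<lambda>u. u * deriv (deriv h) u + p u * deriv h u + q u * h u) has_fps_expansion
      (fps_X * fps_deriv (fps_deriv H) + P * fps_deriv H + Q * H)"
    by (intro fps_expansion_intros)
  moreover have "(\<lambda>u. u * deriv (deriv h) u + p u * deriv h u + q u * h u) has_fps_expansion 0"
    unfolding has_fps_expansion_0_iff
    using eventually_nhds_in_open[OF open_ball, of 0 0 e] e by (auto elim!: eventually_mono simp: ode)
  ultimately have eq: "fps_X * fps_deriv (fps_deriv H) + P * fps_deriv H + Q * H = 0"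
    by (rule fps_expansion_unique_complex)
  have "fps_nth P 0 = p 0"
    using fps_nth_fps_expansion[OF \<open>p has_fps_expansion P\<close>, of 0] by simp
  moreover have "fps_conv_radius P \<ge> 1" "fps_conv_radius Q \<ge> 1"
    using holomorphic_on_imp_fps_conv_radius_ge[OF \<open>p has_fps_expansion P\<close>, of 1]
      holomorphic_on_imp_fps_conv_radius_ge[OF \<open>q has_fps_expansion Q\<close>, of 1] p q
    by (simp_all add: one_ereal_def)
  ultimately have "fps_conv_radius H \<ge> 1"
    using frobenius_conv_radius[OF eq] nz by simp
  then have "eval_fps H holomorphic_on ball 0 1"
    using less_le_trans[of "ereal _" 1 "fps_conv_radius H"]
    by (intro holomorphic_on_eval_fps) (auto simp: subset_eq in_eball_iff)
  moreover have "eventually (\<lambda>u. eval_fps H u = h u) (nhds 0)"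
    using \<open>h has_fps_expansion H\<close> by (simp add: has_fps_expansion_def)
  ultimately show ?thesis by (rule that)
qed

text \<open>The chain rule for two changes of variable: the rational map from the disc in
  \<open>hyp_lift_exists\<close>, and X = 1 - exp z.\<close>

lemma deriv2_compose_eval_fps:
  fixes \<phi> \<phi>1 \<phi>2 :: "complex \<Rightarrow> complex"
  assumes r: "fps_conv_radius H \<ge> 1" and S: "open S"
    and \<phi>1: "\<And>z. z \<in> S \<Longrightarrow> (\<phi> has_field_derivative \<phi>1 z) (at z)"
    and \<phi>2: "\<And>z. z \<in> S \<Longrightarrow> (\<phi>1 has_field_derivative \<phi>2 z) (at z)"
    and lt: "\<And>z. z \<in> S \<Longrightarrow> norm (\<phi> z) < 1"
    and h: "\<And>z. z \<in> S \<Longrightarrow> h z = eval_fps H (\<phi> z)" and z: "z \<in> S"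
  shows "deriv h z = eval_fps (fps_deriv H) (\<phi> z) * \<phi>1 z"
    and "deriv (deriv h) z = eval_fps (fps_deriv (fps_deriv H)) (\<phi> z) * (\<phi>1 z)\<^sup>2
      + eval_fps (fps_deriv H) (\<phi> z) * \<phi>2 z"
    and "h field_differentiable at z"
proof -
  have r': "fps_conv_radius (fps_deriv H) \<ge> 1"
    using r fps_conv_radius_deriv[of H] by simp
  have lt': "ereal (norm (\<phi> z)) < fps_conv_radius H" "ereal (norm (\<phi> z)) < fps_conv_radius (fps_deriv H)"
    if "z \<in> S" for z
    using lt[OF that] r r' less_le_trans[of "ereal (norm (\<phi> z))" 1] by auto
  have d1: "(h has_field_derivative eval_fps (fps_deriv H) (\<phi> z) * \<phi>1 z) (at z)" if "z \<in> S" for z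
    by (rule has_field_derivative_transform_within_open[OF _ S that, where f = "\<lambda>z. eval_fps H (\<phi> z)"])
      (use h that lt'[OF that] in \<open>auto intro!: DERIV_chain2[OF has_field_derivative_eval_fps] \<phi>1\<close>)
  then have *: "deriv h z = eval_fps (fps_deriv H) (\<phi> z) * \<phi>1 z" if "z \<in> S" for z
    using that by (simp add: DERIV_imp_deriv)
  show "deriv h z = eval_fps (fps_deriv H) (\<phi> z) * \<phi>1 z" by (rule *[OF z])
  show "h field_differentiable at z" using d1[OF z] by (auto simp: field_differentiable_def)
  have "(deriv h has_field_derivative eval_fps (fps_deriv (fps_deriv H)) (\<phi> z) * \<phi>1 z * \<phi>1 z
      + \<phi>2 z * eval_fps (fps_deriv H) (\<phi> z)) (at z)"
    by (rule has_field_derivative_transform_within_open[OF _ S z, where f = "\<lambda>z. eval_fps (fps_deriv H) (\<phi> z) * \<phi>1 z"])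
      (use * z lt'[OF z] in \<open>auto intro!: DERIV_mult DERIV_chain2[OF has_field_derivative_eval_fps] \<phi>1 \<phi>2\<close>)
  then show "deriv (deriv h) z = eval_fps (fps_deriv (fps_deriv H)) (\<phi> z) * (\<phi>1 z)\<^sup>2
      + eval_fps (fps_deriv H) (\<phi> z) * \<phi>2 z"
    by (simp add: DERIV_imp_deriv power2_eq_square mult_ac)
qed

section \<open>From formal identities to germs at the origin\<close>

lemma hyp_fps_ode_near_0:
  assumes "c \<notin> \<int>\<^sub>\<le>\<^sub>0"
  shows "eventually (\<lambda>X. X * ((1 - X) * eval_fps (fps_deriv (fps_deriv (hyp_fps a b c))) X)
    + (c - (a + b + 1) * X) * eval_fps (fps_deriv (hyp_fps a b c)) X
    - a * b * eval_fps (hyp_fps a b c) X = 0) (nhds 0)"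
proof -
  define H where "H = hyp_fps a b c"
  have r: "fps_conv_radius H > 0" using hyp_fps_conv_radius[OF assms, of a b]
    by (auto simp: H_def intro: less_le_trans[of _ 1])
  have [fps_expansion_intros]: "eval_fps H has_fps_expansion H"
    "eval_fps (fps_deriv H) has_fps_expansion fps_deriv H"
    "eval_fps (fps_deriv (fps_deriv H)) has_fps_expansion fps_deriv (fps_deriv H)"
    using r fps_conv_radius_deriv[of H] fps_conv_radius_deriv[of "fps_deriv H"]
    by (auto intro!: eval_fps_has_fps_expansion elim: less_le_trans)
  have "(\<lambda>X. X * ((1 - X) * eval_fps (fps_deriv (fps_deriv H)) X)
    + (c - (a + b + 1) * X) * eval_fps (fps_deriv H) X - a * b * eval_fps H X) has_fps_expansion
     (fps_X * ((1 - fps_X) * fps_deriv (fps_deriv H))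
    + (fps_const c - fps_const (a + b + 1) * fps_X) * fps_deriv H - fps_const (a * b) * H)"
    by (intro fps_expansion_intros)
  then show ?thesis
    unfolding H_def hyp_fps_ode[OF assms] has_fps_expansion_0_iff .
qed

lemma hyp_fps_contiguous_near_0:
  assumes "c \<notin> \<int>\<^sub>\<le>\<^sub>0"
  shows "eventually (\<lambda>X. (1 - X) * eval_fps (fps_deriv (fps_deriv (hyp_fps a b c))) X
    + (c - a - b - 1) * eval_fps (fps_deriv (hyp_fps a b c)) X
    = a * b * (c - a) * (c - b) / (c * (c + 1)) * eval_fps (hyp_fps (a + 1) (b + 1) (c + 2)) X) (nhds 0)"
proof -
  define H where "H = hyp_fps a b c"
  define K where "K = hyp_fps (a + 1) (b + 1) (c + 2)"
  define k where "k = a * b * (c - a) * (c - b) / (c * (c + 1))"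
  have r: "fps_conv_radius H > 0" using hyp_fps_conv_radius[OF assms, of a b]
    by (auto simp: H_def intro: less_le_trans[of _ 1])
  have rK: "fps_conv_radius K > 0"
    using hyp_fps_conv_radius[OF add_of_nat_not_nonpos_Ints[OF assms, of 2], of "a + 1" "b + 1"]
    by (auto simp: K_def intro: less_le_trans[of _ 1])
  have [fps_expansion_intros]: "eval_fps H has_fps_expansion H" "eval_fps K has_fps_expansion K"
    "eval_fps (fps_deriv H) has_fps_expansion fps_deriv H"
    "eval_fps (fps_deriv (fps_deriv H)) has_fps_expansion fps_deriv (fps_deriv H)"
    using r rK fps_conv_radius_deriv[of H] fps_conv_radius_deriv[of "fps_deriv H"]
    by (auto intro!: eval_fps_has_fps_expansion elim: less_le_trans)
  have "(\<lambda>X. (1 - X) * eval_fps (fps_deriv (fps_deriv H)) X + (c - a - b - 1) * eval_fps (fps_deriv H) X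
      - k * eval_fps K X) has_fps_expansion
     ((1 - fps_X) * fps_deriv (fps_deriv H) + fps_const (c - a - b - 1) * fps_deriv H - fps_const k * K)"
    by (intro fps_expansion_intros)
  then show ?thesis
    using hyp_fps_contiguous[OF assms, of a b] unfolding H_def[symmetric] K_def[symmetric] k_def[symmetric]
    by (simp add: has_fps_expansion_0_iff)
qed

text \<open>Two radii matter: \<open>pi\<close> for logarithms of points off the non-positive reals,
  and \<open>2 * pi\<close> for sums of two such logarithms.\<close>

definition strip :: "real \<Rightarrow> complex set" where
  "strip r = {z. \<bar>Im z\<bar> < r}"

lemma open_strip [simp]: "open (strip r)"
  unfolding strip_def by (intro open_Collect_less continuous_intros)

lemma convex_strip [simp]: "convex (strip r)"
proof -
  have "strip r = {z. Im z < r} \<inter> {z. Im z > - r}" by (auto simp: strip_def)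
  then show ?thesis by (simp add: convex_Int convex_halfspace_Im_lt convex_halfspace_Im_gt)
qed

lemma connected_strip [simp]: "connected (strip r)"
  by (simp add: convex_connected)

lemma zero_in_strip [simp]: "0 \<in> strip r \<longleftrightarrow> r > 0"
  by (simp add: strip_def)

text \<open>The substitution $u = \tanh(z/8)$ maps the strip to the unit disc; there the hypergeometric
  equation has its only singularity at $u = 0$, so the Frobenius series converges on the whole disc.\<close>

lemma hyp_lift_exists:
  assumes c: "c \<notin> \<int>\<^sub>\<le>\<^sub>0"
  shows "\<exists>g. g holomorphic_on strip (2 * pi) \<and>
    eventually (\<lambda>z. g z = eval_fps (hyp_fps a b c) (1 - exp z)) (nhds 0)"
proof -
  define H where "H = hyp_fps a b c"
  \<comment> \<open>For u = tanh(z/8) one has exp(z/4) = (1 + u)/(1 - u), so \<psi> is X = 1 - exp z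
    as a function of u, followed by its two derivatives. In the open disc \<psi> vanishes only at 0
    and never equals 1.\<close>
  define \<psi> \<psi>1 \<psi>2 :: "complex \<Rightarrow> complex" where
    "\<psi> u = 1 - (1 + u) ^ 4 / (1 - u) ^ 4"
    and "\<psi>1 u = - 8 * (1 + u) ^ 3 / (1 - u) ^ 5"
    and "\<psi>2 u = - 8 * (3 * (1 + u) ^ 2 / (1 - u) ^ 5 + 5 * (1 + u) ^ 3 / (1 - u) ^ 6)" for u
  obtain S0 where S0: "open S0" "0 \<in> S0" and odeS: "\<And>X. X \<in> S0 \<Longrightarrow> X * ((1 - X) * eval_fps (fps_deriv (fps_deriv H)) X)
    + (c - (a + b + 1) * X) * eval_fps (fps_deriv H) X - a * b * eval_fps H X = 0"
    using hyp_fps_ode_near_0[OF c, of a b] unfolding H_def[symmetric] eventually_nhds by blast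
  have nz: "1 - u \<noteq> 0" "1 + u \<noteq> 0" "1 + u\<^sup>2 \<noteq> 0" if "u \<in> ball 0 1" for u :: complex
  proof -
    have "norm u < 1" "norm (u\<^sup>2) < 1" using that by (simp_all add: norm_power abs_square_less_1)
    then show "1 - u \<noteq> 0" "1 + u \<noteq> 0" "1 + u\<^sup>2 \<noteq> 0"
      by (auto simp: add_eq_0_iff)
  qed
  have d1: "(\<psi> has_field_derivative \<psi>1 u) (at u)" and d2: "(\<psi>1 has_field_derivative \<psi>2 u) (at u)"
    if "u \<in> ball 0 1" for u
  proof -
    have "1 - u \<noteq> 0" using nz[OF that] by simp
    then show "(\<psi> has_field_derivative \<psi>1 u) (at u)" "(\<psi>1 has_field_derivative \<psi>2 u) (at u)"
      unfolding \<psi>_def [abs_def] \<psi>1_def [abs_def] \<psi>2_def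
      by - ((rule derivative_eq_intros refl | simp; fail)+, simp add: divide_simps, algebra)+
  qed
  have "continuous_on (ball 0 1) \<psi>"
    by (rule DERIV_continuous_on[where D = \<psi>1]) (use d1 in \<open>auto intro: has_field_derivative_at_within\<close>)
  then have "open (ball 0 1 \<inter> \<psi> -` (S0 \<inter> ball 0 1))"
    using S0 by (intro continuous_open_preimage) auto
  moreover have "0 \<in> ball 0 1 \<inter> \<psi> -` (S0 \<inter> ball 0 1)" using S0 by (simp add: \<psi>_def)
  ultimately obtain e where e: "e > 0" "ball 0 e \<subseteq> ball 0 1 \<inter> \<psi> -` (S0 \<inter> ball 0 1)"
    by (meson open_contains_ball)
  define h where "h = (\<lambda>u. eval_fps H (\<psi> u))"
  \<comment> \<open>\<open>K\<close> and \<open>p\<close> are solved from u \<psi>'^2 = K \<psi> (1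
    - \<psi>) and u \<psi>'' + p \<psi>' = K (c - (a + b + 1) \<psi>), so that \<open>K\<close>
    times the equation in X is the Frobenius form in u. At 0 this gives p(0) = c, the same indicial
    factor as before.\<close>
  define p where "p = (\<lambda>u. - u * (3 / (1 + u) + 5 / (1 - u)) + c * (1 - u) ^ 3 / ((1 + u\<^sup>2) * (1 + u))
      + 8 * (a + b + 1) * u / ((1 + u) * (1 - u)))"
  define K where "K = (\<lambda>u::complex. - 8 * (1 + u)\<^sup>2 / ((1 + u\<^sup>2) * (1 - u)\<^sup>2))"
  define q where "q = (\<lambda>u. - K u * (a * b))"
  have dh: "deriv h u = eval_fps (fps_deriv H) (\<psi> u) * \<psi>1 u"
    "deriv (deriv h) u = eval_fps (fps_deriv (fps_deriv H)) (\<psi> u) * (\<psi>1 u)\<^sup>2 + eval_fps (fps_deriv H) (\<psi> u) * \<psi>2 u"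
    "h field_differentiable at u" if "u \<in> ball 0 e" for u
  proof -
    have "fps_conv_radius H \<ge> 1" unfolding H_def by (rule hyp_fps_conv_radius[OF c])
    moreover have "\<psi> z \<in> ball 0 1" "z \<in> ball 0 1" if "z \<in> ball 0 e" for z using e that by auto
    ultimately show "deriv h u = eval_fps (fps_deriv H) (\<psi> u) * \<psi>1 u"
      "deriv (deriv h) u = eval_fps (fps_deriv (fps_deriv H)) (\<psi> u) * (\<psi>1 u)\<^sup>2 + eval_fps (fps_deriv H) (\<psi> u) * \<psi>2 u"
      "h field_differentiable at u"
      using deriv2_compose_eval_fps[where H = H and S = "ball 0 e" and \<phi> = \<psi> and ?\<phi>1.0 = \<psi>1 and ?\<phi>2.0 = \<psi>2 and h = h and z = u]
        d1 d2 that by (simp_all add: h_def)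
  qed
  obtain G where G: "G holomorphic_on ball 0 1" "eventually (\<lambda>u. G u = h u) (nhds 0)"
  proof (rule frobenius_extension)
    show "h holomorphic_on ball 0 e"
      using dh(3) by (simp add: holomorphic_on_def field_differentiable_at_within)
    show "e > 0" by fact
    show "p holomorphic_on ball 0 1" "q holomorphic_on ball 0 1"
      unfolding p_def q_def K_def by (intro holomorphic_intros; use nz in simp)+
    show "p 0 + of_nat n \<noteq> 0" for n
      using add_of_nat_nonpos_Ints_neq(1)[OF c] by (simp add: p_def)
    fix u :: complex assume u: "u \<in> ball 0 e"
    then have u1: "u \<in> ball 0 1" and uS: "\<psi> u \<in> S0" using e by auto
    note nzu = nz[OF u1]
    have "\<psi> u = ((1 - u) ^ 4 - (1 + u) ^ 4) / (1 - u) ^ 4"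
      using nzu by (simp add: \<psi>_def diff_divide_distrib)
    also have "(1 - u) ^ 4 - (1 + u) ^ 4 = - 8 * u * (1 + u\<^sup>2)" by algebra
    finally have psi: "\<psi> u = - 8 * u * (1 + u\<^sup>2) / (1 - u) ^ 4" .
    have i1: "u * (\<psi>1 u)\<^sup>2 = K u * (\<psi> u * (1 - \<psi> u))"
    proof -
      have "1 - \<psi> u = (1 + u) ^ 4 / (1 - u) ^ 4" by (simp add: \<psi>_def)
      then show ?thesis using nzu unfolding psi K_def \<psi>1_def
        by (simp add: divide_simps)
    qed
    have i2: "u * \<psi>2 u + p u * \<psi>1 u = K u * (c - (a + b + 1) * \<psi> u)"
      using nzu unfolding psi K_def \<psi>1_def \<psi>2_def p_def
      by (simp add: divide_simps) algebra
    have "u * deriv (deriv h) u + p u * deriv h u + q u * h u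
      = eval_fps (fps_deriv (fps_deriv H)) (\<psi> u) * (u * (\<psi>1 u)\<^sup>2)
        + eval_fps (fps_deriv H) (\<psi> u) * (u * \<psi>2 u + p u * \<psi>1 u) - K u * (a * b) * eval_fps H (\<psi> u)"
      unfolding dh[OF u] by (simp add: h_def q_def algebra_simps)
    also have "\<dots> = K u * (\<psi> u * ((1 - \<psi> u) * eval_fps (fps_deriv (fps_deriv H)) (\<psi> u))
      + (c - (a + b + 1) * \<psi> u) * eval_fps (fps_deriv H) (\<psi> u) - a * b * eval_fps H (\<psi> u))"
      unfolding i1 i2 by (simp add: algebra_simps)
    also have "\<dots> = 0" unfolding odeS[OF uS] by simp
    finally show "u * deriv (deriv h) u + p u * deriv h u + q u * h u = 0" .
  qed
  \<comment> \<open>On the strip |Im(z/4)| < pi/2, so exp(z/4) lies in the right half-plane, which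
    this Cayley transform carries into the unit disc.\<close>
  define \<tau> where "\<tau> = (\<lambda>z::complex. (exp (z / 4) - 1) / (exp (z / 4) + 1))"
  have pos: "Re (exp (z / 4)) > 0" if "z \<in> strip (2 * pi)" for z
    using that by (auto simp: strip_def Re_exp intro!: mult_pos_pos cos_gt_zero_pi)
  have nzt: "exp (z / 4) + 1 \<noteq> 0" if "z \<in> strip (2 * pi)" for z
    using pos[OF that] by (auto simp: complex_eq_iff)
  have "\<tau> holomorphic_on strip (2 * pi)"
    unfolding \<tau>_def by (intro holomorphic_intros; use nzt in simp)
  moreover have \<tau>1: "\<tau> z \<in> ball 0 1" if "z \<in> strip (2 * pi)" for z
  proof -
    let ?w = "exp (z / 4)"
    have "(norm (?w - 1))\<^sup>2 < (norm (?w + 1))\<^sup>2"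
      using pos[OF that] by (simp only: cmod_power2) (simp add: power2_eq_square algebra_simps)
    then have "norm (?w - 1) < norm (?w + 1)" by (rule power_less_imp_less_base) simp
    then show ?thesis using nzt[OF that] by (simp add: \<tau>_def norm_divide divide_simps)
  qed
  ultimately have "(G \<circ> \<tau>) holomorphic_on strip (2 * pi)"
    by (intro holomorphic_on_compose_gen[OF _ G(1)]) auto
  moreover have "eventually (\<lambda>z. (G \<circ> \<tau>) z = eval_fps H (1 - exp z)) (nhds 0)"
  proof -
    have "isCont \<tau> 0" unfolding \<tau>_def by (intro continuous_intros) simp_all
    then have "filterlim \<tau> (nhds 0) (nhds 0)"
      using tendsto_at_iff_tendsto_nhds[of \<tau> 0] by (simp add: isCont_def) (simp add: \<tau>_def)
    from eventually_compose_filterlim[OF G(2) this]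
    have "eventually (\<lambda>z. G (\<tau> z) = h (\<tau> z)) (nhds 0)" .
    moreover have "eventually (\<lambda>z. z \<in> strip (2 * pi)) (nhds 0)"
      by (intro eventually_nhds_in_open) simp_all
    ultimately show ?thesis
    proof eventually_elim
      case (elim z)
      note n = nzt[OF elim(2)]
      have "1 + \<tau> z = 2 * exp (z / 4) / (exp (z / 4) + 1)" "1 - \<tau> z = 2 / (exp (z / 4) + 1)"
        using n by (simp_all add: \<tau>_def divide_simps)
      then have "(1 + \<tau> z) / (1 - \<tau> z) = exp (z / 4)" using n by simp
      then have "\<psi> (\<tau> z) = 1 - exp (z / 4) ^ 4" by (simp add: \<psi>_def flip: power_divide)
      also have "exp (z / 4) ^ 4 = exp z" by (simp flip: exp_of_nat_mult)
      finally show ?case using elim by (simp add: h_def)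
    qed
  qed
  ultimately show ?thesis unfolding H_def by blast
qed

text \<open>On the strip the choice is determined by its germ at 0, the only point there with X = 0.
  Points z and z + 2 pi i have the same X but may carry different values, so different sheets of F
  are kept apart.\<close>

definition hyp_lift :: "complex \<Rightarrow> complex \<Rightarrow> complex \<Rightarrow> complex \<Rightarrow> complex" where
  "hyp_lift a b c = (SOME g. g holomorphic_on strip (2 * pi) \<and>
    eventually (\<lambda>z. g z = eval_fps (hyp_fps a b c) (1 - exp z)) (nhds 0))"

lemma
  assumes "c \<notin> \<int>\<^sub>\<le>\<^sub>0"
  shows hyp_lift_holomorphic: "hyp_lift a b c holomorphic_on strip (2 * pi)"
    and hyp_lift_near_0: "eventually (\<lambda>z. hyp_lift a b c z = eval_fps (hyp_fps a b c) (1 - exp z)) (nhds 0)"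
  using someI_ex[OF hyp_lift_exists[OF assms, of a b]] unfolding hyp_lift_def by blast+

lemma hyp_lift_0:
  assumes "c \<notin> \<int>\<^sub>\<le>\<^sub>0"
  shows "hyp_lift a b c 0 = 1"
  using eventually_nhds_x_imp_x[OF hyp_lift_near_0[OF assms, of a b]] by (simp add: eval_fps_at_0)

lemma hyp_lift_derivs_near_0:
  assumes "c \<notin> \<int>\<^sub>\<le>\<^sub>0"
  shows "eventually (\<lambda>z. hyp_lift a b c z = eval_fps (hyp_fps a b c) (1 - exp z) \<and>
     deriv (hyp_lift a b c) z = - exp z * eval_fps (fps_deriv (hyp_fps a b c)) (1 - exp z) \<and>
     deriv (deriv (hyp_lift a b c)) z = exp z * exp z * eval_fps (fps_deriv (fps_deriv (hyp_fps a b c))) (1 - exp z)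
       - exp z * eval_fps (fps_deriv (hyp_fps a b c)) (1 - exp z)) (nhds 0)"
proof -
  define g where "g = hyp_lift a b c"
  define H where "H = hyp_fps a b c"
  obtain S where S: "open S" "0 \<in> S" "\<And>z. z \<in> S \<Longrightarrow> g z = eval_fps H (1 - exp z)"
    using hyp_lift_near_0[OF assms, of a b] unfolding eventually_nhds g_def H_def by blast
  define T where "T = S \<inter> {z. norm (1 - exp z) < 1}"
  have T: "open T" "0 \<in> T"
    unfolding T_def using S by (auto intro!: open_Int open_Collect_less continuous_intros)
  have "g z = eval_fps H (1 - exp z) \<and> deriv g z = - exp z * eval_fps (fps_deriv H) (1 - exp z) \<and>
     deriv (deriv g) z = exp z * exp z * eval_fps (fps_deriv (fps_deriv H)) (1 - exp z)
       - exp z * eval_fps (fps_deriv H) (1 - exp z)" if z: "z \<in> T" for z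
  proof -
    have r: "fps_conv_radius H \<ge> 1" unfolding H_def by (rule hyp_fps_conv_radius[OF assms])
    have d: "((\<lambda>z. 1 - exp z) has_field_derivative - exp z) (at z)"
      "((\<lambda>z. - exp z) has_field_derivative - exp z) (at z)" for z :: complex
      by (auto intro!: derivative_eq_intros)
    show ?thesis
      using deriv2_compose_eval_fps[OF r T(1), where \<phi> = "\<lambda>z. 1 - exp z" and ?\<phi>1.0 = "\<lambda>z. - exp z"
          and ?\<phi>2.0 = "\<lambda>z. - exp z" and h = g and z = z, OF d] S(3) z
      by (auto simp: T_def power2_eq_square)
  qed
  then show ?thesis
    using eventually_nhds_in_open[OF T] unfolding g_def H_def by (auto elim!: eventually_mono)
qed

text \<open>Since 1 - X = exp z, the derivatives in X are H' = - exp(-z) g' and H'' = exp(-2z)(g'' -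
  g'). Both relations therefore hold as germs at 0, after multiplication by exp z, and the identity
  theorem spreads them over the connected strip.\<close>

lemma
  assumes c: "c \<notin> \<int>\<^sub>\<le>\<^sub>0" and z: "z \<in> strip (2 * pi)"
  shows hyp_lift_ode: "(1 - exp z) * (deriv (deriv (hyp_lift a b c)) z - deriv (hyp_lift a b c) z)
      - (c - (a + b + 1) * (1 - exp z)) * deriv (hyp_lift a b c) z
      - a * b * exp z * hyp_lift a b c z = 0" (is "?L z = 0")
    and hyp_lift_contiguous: "deriv (deriv (hyp_lift a b c)) z - (c - a - b) * deriv (hyp_lift a b c) z
      = a * b * (c - a) * (c - b) / (c * (c + 1)) * exp z * hyp_lift (a + 1) (b + 1) (c + 2) z"
        (is "?M z = ?k * exp z * ?N z")
proof -
  define H where "H = hyp_fps a b c"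
  have c2: "c + 2 \<notin> \<int>\<^sub>\<le>\<^sub>0" using add_of_nat_not_nonpos_Ints[OF c, of 2] by simp
  have hol: "hyp_lift a b c holomorphic_on strip (2 * pi)" "?N holomorphic_on strip (2 * pi)"
    "deriv (hyp_lift a b c) holomorphic_on strip (2 * pi)"
    "deriv (deriv (hyp_lift a b c)) holomorphic_on strip (2 * pi)"
    using hyp_lift_holomorphic[OF c] hyp_lift_holomorphic[OF c2] by (auto intro!: holomorphic_deriv)
  have lim: "filterlim (\<lambda>z::complex. 1 - exp z) (nhds 0) (nhds 0)"
  proof -
    have "isCont (\<lambda>z::complex. 1 - exp z) 0" by (intro continuous_intros)
    then show ?thesis
      using tendsto_at_iff_tendsto_nhds[of "\<lambda>z::complex. 1 - exp z" 0] by (simp add: isCont_def)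
  qed
  have "eventually (\<lambda>z. ?L z = 0) (nhds 0)"
    using hyp_lift_derivs_near_0[OF c, of a b] eventually_compose_filterlim[OF hyp_fps_ode_near_0[OF c, of a b] lim]
  proof eventually_elim
    case (elim z)
    have "?L z = exp z * ((1 - exp z) * ((1 - (1 - exp z)) * eval_fps (fps_deriv (fps_deriv H)) (1 - exp z))
      + (c - (a + b + 1) * (1 - exp z)) * eval_fps (fps_deriv H) (1 - exp z) - a * b * eval_fps H (1 - exp z))"
      using elim(1) unfolding H_def[symmetric] by (simp add: algebra_simps)
    also have "\<dots> = 0" unfolding H_def elim(2) by simp
    finally show ?case .
  qed
  then show "?L z = 0"
    by (intro has_fps_expansion_0_analytic_continuation[of ?L "strip (2 * pi)"])
      (use z hol in \<open>auto simp: has_fps_expansion_0_iff intro!: holomorphic_intros\<close>)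
  have "eventually (\<lambda>z. ?M z - ?k * exp z * ?N z = 0) (nhds 0)"
    using hyp_lift_derivs_near_0[OF c, of a b] eventually_compose_filterlim[OF hyp_fps_contiguous_near_0[OF c, of a b] lim]
      hyp_lift_near_0[OF c2, of "a + 1" "b + 1"]
  proof eventually_elim
    case (elim z)
    have "?M z = exp z * ((1 - (1 - exp z)) * eval_fps (fps_deriv (fps_deriv H)) (1 - exp z)
      + (c - a - b - 1) * eval_fps (fps_deriv H) (1 - exp z))"
      using elim(1) unfolding H_def[symmetric] by (simp add: algebra_simps)
    also have "\<dots> = ?k * exp z * ?N z" unfolding H_def elim(2) elim(3) by (simp add: mult_ac)
    finally show ?case by simp
  qed
  then have "?M z - ?k * exp z * ?N z = 0"
    by (intro has_fps_expansion_0_analytic_continuation[of "\<lambda>z. ?M z - ?k * exp z * ?N z" "strip (2 * pi)"])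
      (use z hol in \<open>auto simp: has_fps_expansion_0_iff intro!: holomorphic_intros\<close>)
  then show "?M z = ?k * exp z * ?N z" by simp
qed

subsection \<open>Local Burchnall--Chaundy expansion\<close>

text \<open>The $k$-th term of the Burchnall--Chaundy expansion is \<open>bc_coeff a b c k\<close> times \<open>bc_lift a b c k\<close> times $(XY)^k$.\<close>

definition bc_coeff :: "complex \<Rightarrow> complex \<Rightarrow> complex \<Rightarrow> nat \<Rightarrow> complex" where
  "bc_coeff a b c k = pochhammer a k * pochhammer b k * pochhammer (c - a) k * pochhammer (c - b) k /
     (fact k * pochhammer c k * pochhammer c (2 * k))"

definition bc_lift :: "complex \<Rightarrow> complex \<Rightarrow> complex \<Rightarrow> nat \<Rightarrow> complex \<Rightarrow> complex" where
  "bc_lift a b c k = hyp_lift (a + of_nat k) (b + of_nat k) (c + 2 * of_nat k)"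

text \<open>The constant of the contiguous relation at the parameters a + k, b + k, c + 2k. It is
  also, up to the factor (k + 1)(c + k), the quotient of consecutive values of
  \<open>bc_coeff\<close>.\<close>

definition bc_ratio :: "complex \<Rightarrow> complex \<Rightarrow> complex \<Rightarrow> nat \<Rightarrow> complex" where
  "bc_ratio a b c k = (a + of_nat k) * (b + of_nat k) * (c - a + of_nat k) * (c - b + of_nat k) /
     ((c + 2 * of_nat k) * (c + 2 * of_nat k + 1))"

text \<open>Multiplied out because (k + 1)(k + c) is what the operator produces from the power k + 1
  of XY, and \<open>bc_ratio\<close> what it produces from the function at level k; the two
  contributions must cancel.\<close>

lemma bc_coeff_Suc:
  assumes c: "c \<notin> \<int>\<^sub>\<le>\<^sub>0"
  shows "bc_coeff a b c (Suc k) * (of_nat (Suc k) * (of_nat k + c)) = bc_coeff a b c k * bc_ratio a b c k"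
proof -
  have nz: "of_nat k + c \<noteq> 0" "(of_nat (Suc k) :: complex) \<noteq> 0" "c + of_nat k \<noteq> 0"
    using add_of_nat_nonpos_Ints_neq[OF c, of k] of_nat_neq_0[of k, where 'a = complex] by simp_all
  have "bc_coeff a b c (Suc k) = bc_coeff a b c k * bc_ratio a b c k / (of_nat (Suc k) * (c + of_nat k))"
    unfolding bc_coeff_def bc_ratio_def
    by (simp add: pochhammer_Suc mult_ac add_ac)
  then show ?thesis using nz by (simp add: add.commute del: of_nat_Suc)
qed

lemma two_k_not_nonpos_Ints:
  assumes "(c::complex) \<notin> \<int>\<^sub>\<le>\<^sub>0"
  shows "c + 2 * of_nat k \<notin> \<int>\<^sub>\<le>\<^sub>0"
  using add_of_nat_not_nonpos_Ints[OF assms, of "2 * k"] by simp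

lemma bc_lift_holomorphic:
  assumes "c \<notin> \<int>\<^sub>\<le>\<^sub>0"
  shows "bc_lift a b c k holomorphic_on strip (2 * pi)"
  unfolding bc_lift_def by (intro hyp_lift_holomorphic two_k_not_nonpos_Ints assms)

lemma bc_lift_ode:
  assumes "c \<notin> \<int>\<^sub>\<le>\<^sub>0" "z \<in> strip (2 * pi)"
  shows "(1 - exp z) * (deriv (deriv (bc_lift a b c k)) z - deriv (bc_lift a b c k) z)
      - (c + 2 * of_nat k - (a + b + 2 * of_nat k + 1) * (1 - exp z)) * deriv (bc_lift a b c k) z
      - (a + of_nat k) * (b + of_nat k) * exp z * bc_lift a b c k z = 0"
  using hyp_lift_ode[OF two_k_not_nonpos_Ints[OF assms(1), of k] assms(2), of "a + of_nat k" "b + of_nat k"]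
  unfolding bc_lift_def[symmetric] by (simp add: algebra_simps)

lemma bc_lift_contiguous:
  assumes "c \<notin> \<int>\<^sub>\<le>\<^sub>0" "z \<in> strip (2 * pi)"
  shows "deriv (deriv (bc_lift a b c k)) z - (c - a - b) * deriv (bc_lift a b c k) z
      = bc_ratio a b c k * exp z * bc_lift a b c (Suc k) z"
proof -
  have "hyp_lift (a + of_nat k + 1) (b + of_nat k + 1) (c + 2 * of_nat k + 2) = bc_lift a b c (Suc k)"
    unfolding bc_lift_def by (simp add: algebra_simps)
  then show ?thesis
    using hyp_lift_contiguous[OF two_k_not_nonpos_Ints[OF assms(1), of k] assms(2), of "a + of_nat k" "b + of_nat k"]
    unfolding bc_lift_def[symmetric] bc_ratio_def by (simp add: algebra_simps)
qed

text \<open>The hypergeometric operator $X(1-X)\partial^2 + (c-(a+b+1)X)\partial - ab$, multiplied by $e^z$ and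
  written in the variable $z$ with $X = 1 - e^z$.\<close>

definition hyp_op :: "complex \<Rightarrow> complex \<Rightarrow> complex \<Rightarrow> (complex \<Rightarrow> complex) \<Rightarrow> complex \<Rightarrow> complex" where
  "hyp_op a b c f z = (1 - exp z) * (deriv (deriv f) z - deriv f z)
      - (c - (a + b + 1) * (1 - exp z)) * deriv f z - a * b * exp z * f z"

lemma hyp_op_linear:
  assumes S: "open S" "z \<in> S" and f: "f holomorphic_on S" and g: "\<And>k. k < N \<Longrightarrow> g k holomorphic_on S"
  shows "hyp_op a b c (\<lambda>z. f z * C - (\<Sum>k<N. d k * g k z)) z
    = hyp_op a b c f z * C - (\<Sum>k<N. d k * hyp_op a b c (g k) z)"
proof -
  note df = holomorphic_derivI[OF f S(1)] and df2 = holomorphic_derivI[OF holomorphic_deriv[OF f S(1)] S(1)]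
  have dg: "(g k has_field_derivative deriv (g k) z) (at z)"
    "(deriv (g k) has_field_derivative deriv (deriv (g k)) z) (at z)" if "k < N" "z \<in> S" for k z
    using holomorphic_derivI[OF g[OF that(1)] S(1) that(2)]
      holomorphic_derivI[OF holomorphic_deriv[OF g[OF that(1)] S(1)] S(1) that(2)] by auto
  have 1: "deriv (\<lambda>z. f z * C - (\<Sum>k<N. d k * g k z)) z = deriv f z * C - (\<Sum>k<N. d k * deriv (g k) z)"
    if "z \<in> S" for z
    by (rule DERIV_imp_deriv) (use that in \<open>auto intro!: derivative_eq_intros df dg simp: mult.commute\<close>)
  have 2: "deriv (deriv (\<lambda>z. f z * C - (\<Sum>k<N. d k * g k z))) z
      = deriv (deriv f) z * C - (\<Sum>k<N. d k * deriv (deriv (g k)) z)"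
  proof (rule DERIV_imp_deriv, rule has_field_derivative_transform_within_open[OF _ S])
    show "((\<lambda>z. deriv f z * C - (\<Sum>k<N. d k * deriv (g k) z)) has_field_derivative
        deriv (deriv f) z * C - (\<Sum>k<N. d k * deriv (deriv (g k)) z)) (at z)"
      using S(2) by (auto intro!: derivative_eq_intros df2 dg simp: mult.commute)
  qed (simp add: 1)
  then show ?thesis
    unfolding hyp_op_def 1[OF S(2)] 2
    by (simp add: sum_distrib_left sum_distrib_right sum_subtractf algebra_simps sum.distrib)
qed

text \<open>The operator acts on z for fixed w. The equation of \<open>bc_lift\<close> at z + w,
  where 1 - exp(z + w) = X + Y - XY, removes most of the Leibniz terms, and the contiguous relation
  absorbs the others into the function at level k + 1. Two pieces remain, the second being of the
  same kind as the first piece of the next term.\<close>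

lemma hyp_op_bc_term:
  fixes a b c w z :: complex and k :: nat
  assumes c: "c \<notin> \<int>\<^sub>\<le>\<^sub>0" and z: "z + w \<in> strip (2 * pi)"
  shows "hyp_op a b c (\<lambda>z. ((1 - exp z) * (1 - exp w)) ^ k * bc_lift a b c k (z + w)) z
    = exp z * (1 - exp w) * ((of_nat k - 1 + c) * (of_nat k * ((1 - exp z) * (1 - exp w)) ^ (k - 1)) * bc_lift a b c k (z + w)
        - ((1 - exp z) * (1 - exp w)) ^ k * (bc_ratio a b c k * bc_lift a b c (Suc k) (z + w)))"
proof -
  define Y where "Y = 1 - exp w"
  define Q where "Q z = (1 - exp z) * Y" for z
  define g where "g = bc_lift a b c k"
  define S where "S = {z. z + w \<in> strip (2 * pi)}"
  have S: "open S" "z \<in> S"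
    using z unfolding S_def strip_def by (auto intro!: open_Collect_less continuous_intros)
  note hg = bc_lift_holomorphic[OF c, of a b k, folded g_def]
  have dg: "((\<lambda>z. g (z + w)) has_field_derivative deriv g (z + w)) (at z)"
    "((\<lambda>z. deriv g (z + w)) has_field_derivative deriv (deriv g) (z + w)) (at z)" if "z \<in> S" for z
    using that holomorphic_derivI[OF hg open_strip, of "z + w"]
      holomorphic_derivI[OF holomorphic_deriv[OF hg open_strip] open_strip, of "z + w"]
    by (auto simp: S_def intro!: DERIV_shift[THEN iffD1])
  \<comment> \<open>Derivatives of Q^k with respect to Q. The truncated exponents for k = 0 and k =
    1 are harmless because the integer factors vanish there.\<close>
  define p1 p2 where "p1 z = of_nat k * Q z ^ (k - 1)" and "p2 z = of_nat k * of_nat (k - 1) * Q z ^ (k - 2)" for z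
  have dP: "(Q has_field_derivative - exp z * Y) (at z)" for z
    unfolding Q_def [abs_def] by (auto intro!: derivative_eq_intros)
  have d0: "((\<lambda>z. Q z ^ k) has_field_derivative p1 z * (- exp z * Y)) (at z)" for z
    unfolding p1_def by (auto intro!: derivative_eq_intros dP)
  have d1: "(p1 has_field_derivative p2 z * (- exp z * Y)) (at z)" for z
    unfolding p1_def [abs_def] p2_def by (auto intro!: derivative_eq_intros dP simp: numeral_2_eq_2)
  have dE: "((\<lambda>z. - exp z * Y) has_field_derivative - exp z * Y) (at z)" for z
    by (auto intro!: derivative_eq_intros)
  define u where "u z = Q z ^ k * g (z + w)" for z
  have du: "deriv u z = p1 z * (- exp z * Y) * g (z + w) + Q z ^ k * deriv g (z + w)" if "z \<in> S" for z
    unfolding u_def [abs_def]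
    by (rule DERIV_imp_deriv, rule DERIV_cong[OF DERIV_mult[OF d0 dg(1)[OF that]]]) (simp add: mult_ac)
  have ddu: "deriv (deriv u) z = p2 z * (exp z * Y)\<^sup>2 * g (z + w) - p1 z * (exp z * Y) * g (z + w)
    - 2 * p1 z * (exp z * Y) * deriv g (z + w) + Q z ^ k * deriv (deriv g) (z + w)"
  proof (rule DERIV_imp_deriv, rule has_field_derivative_transform_within_open[OF _ S])
    show "((\<lambda>z. p1 z * (- exp z * Y) * g (z + w) + Q z ^ k * deriv g (z + w)) has_field_derivative
      p2 z * (exp z * Y)\<^sup>2 * g (z + w) - p1 z * (exp z * Y) * g (z + w)
    - 2 * p1 z * (exp z * Y) * deriv g (z + w) + Q z ^ k * deriv (deriv g) (z + w)) (at z)"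
      by (rule DERIV_cong[OF DERIV_add[OF DERIV_mult[OF DERIV_mult[OF d1 dE] dg(1)[OF S(2)]] DERIV_mult[OF d0 dg(2)[OF S(2)]]]])
        (simp add: algebra_simps power2_eq_square)
  qed (simp add: du)
  have r1: "p1 z * ((1 - exp z) * Y) = of_nat k * Q z ^ k"
    by (cases k) (simp_all add: p1_def Q_def)
  have r2: "p2 z * ((1 - exp z) * Y) = (of_nat k - 1) * p1 z"
    by (cases k; cases "k - 1") (simp_all add: p1_def p2_def Q_def algebra_simps)
  \<comment> \<open>A polynomial identity in independent symbols: \<open>p0\<close>,
    \<open>p1\<close>, \<open>p2\<close> stand for the power and its derivatives, tied together by
    \<open>r1\<close> and \<open>r2\<close>, so that no exponent has to be treated.\<close>
  have alg: "X * (p2 * (E * Y)\<^sup>2 * g0 - p1 * (E * Y) * g0 - 2 * p1 * (E * Y) * g1 + p0 * g2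
        - (p1 * (- E * Y) * g0 + p0 * g1))
      - (c - (a + b + 1) * X) * (p1 * (- E * Y) * g0 + p0 * g1) - a * b * E * (p0 * g0)
      = E * Y * ((k - 1 + c) * p1 * g0 - p0 * G)"
    if X: "X = 1 - E" and Y: "Y = 1 - W" and W: "W \<noteq> 0" and r1: "p1 * (X * Y) = k * p0" and r2: "p2 * (X * Y) = (k - 1) * p1"
      and O: "(1 - E * W) * (g2 - g1) - (c + 2 * k - (a + b + 2 * k + 1) * (1 - E * W)) * g1 - (a + k) * (b + k) * (E * W) * g0 = 0"
      and E: "g2 - (c - a - b) * g1 = E * W * G"
    for X Y E W p0 p1 p2 g0 g1 g2 G k :: complex
  proof -
    \<comment> \<open>\<open>G\<close> enters the hypotheses only through E * W * G; multiplying by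
      W makes this product appear on the right.\<close>
    have "W * (X * (p2 * (E * Y)\<^sup>2 * g0 - p1 * (E * Y) * g0 - 2 * p1 * (E * Y) * g1 + p0 * g2
        - (p1 * (- E * Y) * g0 + p0 * g1))
      - (c - (a + b + 1) * X) * (p1 * (- E * Y) * g0 + p0 * g1) - a * b * E * (p0 * g0))
      = W * (E * Y * ((k - 1 + c) * p1 * g0 - p0 * G))"
      using X Y r1 r2 O E by algebra
    then show ?thesis using W by simp
  qed
  have "hyp_op a b c u z = exp z * Y * ((of_nat k - 1 + c) * p1 z * g (z + w)
      - Q z ^ k * (bc_ratio a b c k * bc_lift a b c (Suc k) (z + w)))"
    unfolding hyp_op_def du[OF S(2)] ddu u_def
  proof (rule alg[where W = "exp w"])
    show "(1 - exp z * exp w) * (deriv (deriv g) (z + w) - deriv g (z + w))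
      - (c + 2 * of_nat k - (a + b + 2 * of_nat k + 1) * (1 - exp z * exp w)) * deriv g (z + w)
      - (a + of_nat k) * (b + of_nat k) * (exp z * exp w) * g (z + w) = 0"
      using bc_lift_ode[OF c z, of a b k] unfolding exp_add g_def .
    show "deriv (deriv g) (z + w) - (c - a - b) * deriv g (z + w)
       = exp z * exp w * (bc_ratio a b c k * bc_lift a b c (Suc k) (z + w))"
      using bc_lift_contiguous[OF c z, of a b k] unfolding exp_add g_def by (simp add: mult_ac)
  qed (use r1 r2 in \<open>simp_all add: Y_def\<close>)
  then show ?thesis unfolding u_def [abs_def] Q_def [abs_def] Y_def p1_def g_def .
qed

text \<open>The variables z and w are kept independent, because the operator differentiates in z
  alone; w = t - z is substituted only after the order of vanishing is known.\<close>

definition bc_defect :: "complex \<Rightarrow> complex \<Rightarrow> complex \<Rightarrow> nat \<Rightarrow> complex \<Rightarrow> complex \<Rightarrow> complex" where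
  "bc_defect a b c N z w = bc_lift a b c 0 z * bc_lift a b c 0 w
     - (\<Sum>k<N. bc_coeff a b c k * (((1 - exp z) * (1 - exp w)) ^ k * bc_lift a b c k (z + w)))"

text \<open>The operator annihilates the product of the two functions, w being a parameter, and the
  sum telescopes. What is left has order N - 1 in XY.\<close>

lemma hyp_op_bc_defect:
  assumes c: "c \<notin> \<int>\<^sub>\<le>\<^sub>0" and z: "z \<in> strip (2 * pi)" "z + w \<in> strip (2 * pi)"
  shows "hyp_op a b c (\<lambda>z. bc_defect a b c N z w) z = exp z * (1 - exp w) * (bc_coeff a b c N *
    ((of_nat N - 1 + c) * (of_nat N * ((1 - exp z) * (1 - exp w)) ^ (N - 1)) * bc_lift a b c N (z + w)))"
proof -
  define S where "S = {z. z \<in> strip (2 * pi) \<and> z + w \<in> strip (2 * pi)}"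
  have S: "open S" "z \<in> S"
    using z unfolding S_def strip_def by (auto intro!: open_Collect_less open_Collect_conj continuous_intros)
  have hol: "(\<lambda>z. ((1 - exp z) * (1 - exp w)) ^ k * bc_lift a b c k (z + w)) holomorphic_on S" for k
  proof -
    have "(bc_lift a b c k \<circ> (\<lambda>z. z + w)) holomorphic_on S"
      by (rule holomorphic_on_compose_gen[OF _ bc_lift_holomorphic[OF c]])
        (auto simp: S_def intro!: holomorphic_intros)
    then show ?thesis by (auto simp: o_def intro!: holomorphic_intros)
  qed
  \<comment> \<open>\<open>T k\<close> is the first piece of the k-th term; by
    \<open>bc_coeff_Suc\<close> the second piece is \<open>T (Suc k)\<close>. The factor k gives
    \<open>T 0 = 0\<close>.\<close>
  define T where "T k = bc_coeff a b c k * ((of_nat k - 1 + c) *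
    (of_nat k * ((1 - exp z) * (1 - exp w)) ^ (k - 1)) * bc_lift a b c k (z + w))" for k
  have "hyp_op a b c (bc_lift a b c 0) z = 0"
    using bc_lift_ode[OF c z(1), of a b 0] by (simp add: hyp_op_def)
  moreover have "bc_lift a b c 0 holomorphic_on S"
    by (rule holomorphic_on_subset[OF bc_lift_holomorphic[OF c]]) (auto simp: S_def)
  ultimately have "hyp_op a b c (\<lambda>z. bc_defect a b c N z w) z
    = - (\<Sum>k<N. bc_coeff a b c k * hyp_op a b c (\<lambda>z. ((1 - exp z) * (1 - exp w)) ^ k * bc_lift a b c k (z + w)) z)"
    unfolding bc_defect_def using hol by (subst hyp_op_linear[OF S]) auto
  also have "(\<Sum>k<N. bc_coeff a b c k * hyp_op a b c (\<lambda>z. ((1 - exp z) * (1 - exp w)) ^ k * bc_lift a b c k (z + w)) z)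
    = (\<Sum>k<N. exp z * (1 - exp w) * (T k - T (Suc k)))"
  proof (rule sum.cong[OF refl])
    fix k
    have "T (Suc k) = (bc_coeff a b c (Suc k) * (of_nat (Suc k) * (of_nat k + c))) *
      ((1 - exp z) * (1 - exp w)) ^ k * bc_lift a b c (Suc k) (z + w)"
      by (simp add: T_def mult_ac)
    then show "bc_coeff a b c k * hyp_op a b c (\<lambda>z. ((1 - exp z) * (1 - exp w)) ^ k * bc_lift a b c k (z + w)) z
      = exp z * (1 - exp w) * (T k - T (Suc k))"
      unfolding hyp_op_bc_term[OF c z(2)] bc_coeff_Suc[OF c] T_def by (simp add: algebra_simps)
  qed
  also have "\<dots> = exp z * (1 - exp w) * (T 0 - T N)"
    by (simp add: sum_lessThan_telescope' flip: sum_distrib_left)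
  finally show ?thesis by (simp add: T_def)
qed

lemma tendsto_one_minus_exp_over: "((\<lambda>z::complex. (1 - exp z) / z) \<longlongrightarrow> - 1) (at 0)"
proof -
  have "((\<lambda>z::complex. - ((exp z - 1) / z)) \<longlongrightarrow> - 1) (at 0)"
    by (intro tendsto_minus lim_exp_minus_1)
  moreover have "(\<lambda>z::complex. - ((exp z - 1) / z)) = (\<lambda>z. (1 - exp z) / z)"
    by (simp add: minus_divide_left)
  ultimately show ?thesis by (simp only:)
qed

text \<open>If D has leading term d z^n with n > 0, the operator gives - n (n - 1 + c) d z^(n - 1)
  to leading order, because 1 - exp z behaves like - z. This is nonzero, so n < N is incompatible
  with a right-hand side of order N - 1.\<close>

lemma hyp_op_vanishing_order:
  assumes c: "c \<notin> \<int>\<^sub>\<le>\<^sub>0" and D: "D holomorphic_on ball 0 r" and r: "r > 0" and D0: "D 0 = 0"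
    and M: "isCont M 0" and op: "\<And>z. z \<in> ball 0 r \<Longrightarrow> hyp_op a b c D z = z ^ (N - 1) * M z"
  shows "\<exists>q. q holomorphic_on ball 0 r \<and> (\<forall>z\<in>ball 0 r. D z = z ^ N * q z)"
proof (cases "D constant_on ball 0 r")
  case True
  then have "D z = 0" if "z \<in> ball 0 r" for z
    using D0 that r by (auto simp: constant_on_def)
  then show ?thesis by (intro exI[of _ "\<lambda>_. 0"]) auto
next
  case False
  have r0: "0 \<in> ball 0 r" using r by simp
  obtain g s n where n: "n > 0" and s: "s > 0" "ball (0::complex) s \<subseteq> ball 0 r" and g: "g holomorphic_on ball 0 s"
    and Dg: "\<And>z. z \<in> ball 0 s \<Longrightarrow> D z = z ^ n * g z" and g0: "\<And>z. z \<in> ball 0 s \<Longrightarrow> g z \<noteq> 0"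
    by (rule holomorphic_factor_zero_nonconstant[OF D open_ball connected_ball r0 D0 False], rule that; simp)
  have "N \<le> n"
  proof (rule ccontr)
    assume "\<not> N \<le> n"
    then have nN: "n < N" by simp
    define p1 p2 :: "complex \<Rightarrow> complex" where "p1 z = of_nat n * z ^ (n - 1)" and "p2 z = of_nat n * of_nat (n - 1) * z ^ (n - 2)" for z
    have d: "((\<lambda>z. z ^ n) has_field_derivative p1 z) (at z)" "(p1 has_field_derivative p2 z) (at z)" for z
      unfolding p1_def [abs_def] p2_def by (auto intro!: derivative_eq_intros simp: numeral_2_eq_2)
    note dg = holomorphic_derivI[OF g open_ball] holomorphic_derivI[OF holomorphic_deriv[OF g open_ball] open_ball]
    have D1: "deriv D z = p1 z * g z + deriv g z * z ^ n" if z: "z \<in> ball 0 s" for z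
    proof (rule DERIV_imp_deriv, rule has_field_derivative_transform_within_open[OF _ open_ball z])
      show "((\<lambda>z. z ^ n * g z) has_field_derivative p1 z * g z + deriv g z * z ^ n) (at z)"
        by (rule DERIV_mult[OF d(1) dg(1)[OF z]])
    qed (simp add: Dg)
    have D2: "deriv (deriv D) z = p2 z * g z + deriv g z * p1 z + (deriv (deriv g) z * z ^ n + p1 z * deriv g z)"
      if z: "z \<in> ball 0 s" for z
    proof (rule DERIV_imp_deriv, rule has_field_derivative_transform_within_open[OF _ open_ball z])
      show "((\<lambda>z. p1 z * g z + deriv g z * z ^ n) has_field_derivative
          p2 z * g z + deriv g z * p1 z + (deriv (deriv g) z * z ^ n + p1 z * deriv g z)) (at z)"
        by (rule DERIV_add[OF DERIV_mult[OF d(2) dg(1)[OF z]] DERIV_mult[OF dg(2)[OF z] d(1)]])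
    qed (simp add: D1)
    \<comment> \<open>The operator applied to D, divided by z^(n - 1), arranged so that its limit at
      0 can be read off. For n < N the same quotient is a positive power of z times
      \<open>M\<close>, so it also tends to 0.\<close>
    define R where "R z = ((1 - exp z) / z) * (of_nat n * of_nat (n - 1) * g z + 2 * of_nat n * z * deriv g z
       + z\<^sup>2 * deriv (deriv g) z - of_nat n * z * g z - z\<^sup>2 * deriv g z)
      - (c - (a + b + 1) * (1 - exp z)) * (of_nat n * g z + z * deriv g z) - a * b * exp z * (z * g z)" for z
    have RM: "R z = z ^ (N - n) * M z" if z: "z \<in> ball 0 s" "z \<noteq> 0" for z
    proof -
      have pw: "z ^ n = z ^ (n - 1) * z" using n by (simp flip: power_Suc2)
      have p2': "p2 z * z = of_nat n * of_nat (n - 1) * z ^ (n - 1)"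
      proof -
        obtain m where "n = Suc m" using n by (cases n) auto
        then show ?thesis unfolding p2_def by (cases m) (simp_all add: mult_ac)
      qed
      have "z * hyp_op a b c D z = (1 - exp z) * (p2 z * z * g z + 2 * z * p1 z * deriv g z + z * z ^ n * deriv (deriv g) z
          - z * p1 z * g z - z * z ^ n * deriv g z)
         - z * ((c - (a + b + 1) * (1 - exp z)) * (p1 z * g z + deriv g z * z ^ n) + a * b * exp z * (z ^ n * g z))"
        unfolding hyp_op_def D2[OF z(1)] D1[OF z(1)] Dg[OF z(1)] by (simp add: algebra_simps)
      also have "\<dots> = z ^ (n - 1) * z * R z"
        unfolding p2' p1_def pw R_def using z(2) by (simp add: field_simps power2_eq_square)
      finally have "z ^ (n - 1) * R z = hyp_op a b c D z" using z(2) by simp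
      also have "\<dots> = z ^ (N - 1) * M z" using op s z by blast
      also have "N - 1 = (n - 1) + (N - n)" using nN n by simp
      finally show ?thesis using z(2) by (simp add: power_add)
    qed
    have "isCont g 0" "isCont (deriv g) 0" "isCont (deriv (deriv g)) 0"
      using g s holomorphic_deriv[OF g open_ball] holomorphic_deriv[OF holomorphic_deriv[OF g open_ball] open_ball]
      by (auto dest!: holomorphic_on_imp_continuous_on simp: continuous_on_eq_continuous_at)
    then have tg: "(g \<longlongrightarrow> g 0) (at 0)" "(deriv g \<longlongrightarrow> deriv g 0) (at 0)" "(deriv (deriv g) \<longlongrightarrow> deriv (deriv g) 0) (at 0)"
      by (simp_all add: isCont_def)
    have lim1: "(R \<longlongrightarrow> (- 1) * (of_nat n * of_nat (n - 1) * g 0 + 2 * of_nat n * 0 * deriv g 0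
       + 0\<^sup>2 * deriv (deriv g) 0 - of_nat n * 0 * g 0 - 0\<^sup>2 * deriv g 0)
      - (c - (a + b + 1) * (1 - exp 0)) * (of_nat n * g 0 + 0 * deriv g 0) - a * b * exp 0 * (0 * g 0)) (at 0)"
      unfolding R_def by (intro tendsto_intros tg tendsto_one_minus_exp_over)
    have lim2: "(R \<longlongrightarrow> 0 ^ (N - n) * M 0) (at 0)"
    proof (rule Lim_transform_within_open[OF _ open_ball, of _ _ _ _ 0 s])
      show "((\<lambda>z. z ^ (N - n) * M z) \<longlongrightarrow> 0 ^ (N - n) * M 0) (at 0)"
        using M by (intro tendsto_intros) (simp add: isCont_def)
    qed (use s RM in auto)
    have "(- 1) * (of_nat n * of_nat (n - 1) * g 0) - c * (of_nat n * g 0) = 0"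
      using tendsto_unique[OF trivial_limit_at lim1 lim2] nN by (simp add: power_0_left)
    then have "(of_nat n * g 0) * (c + of_nat (n - 1)) = 0" by algebra
    then show False using n g0[of 0] s add_of_nat_nonpos_Ints_neq(1)[OF c, of "n - 1"] by simp
  qed
  \<comment> \<open>Near 0 the exponent n - N is a genuine difference because N <= n; away from 0
    plain division serves. The two agree on the overlap.\<close>
  define q where "q z = (if z \<in> ball 0 s then z ^ (n - N) * g z else D z / z ^ N)" for z
  have "q holomorphic_on (ball 0 s \<union> (ball 0 r - {0}))"
    unfolding q_def
  proof (rule holomorphic_on_If_Un)
    show "(\<lambda>z. z ^ (n - N) * g z) holomorphic_on ball 0 s" by (intro holomorphic_intros g)
    show "(\<lambda>z. D z / z ^ N) holomorphic_on ball 0 r - {0}"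
      by (intro holomorphic_intros holomorphic_on_subset[OF D]) auto
    fix z :: complex assume "z \<in> ball 0 s" "z \<in> ball 0 r - {0}"
    then show "z ^ (n - N) * g z = D z / z ^ N"
      using \<open>N \<le> n\<close> by (simp add: Dg power_diff)
  qed auto
  moreover have "ball (0::complex) s \<union> (ball 0 r - {0}) = ball 0 r"
  proof -
    have *: "B \<union> (X - {0}) = X" if "0 \<in> B" "B \<subseteq> X" for B X :: "complex set"
      using that by auto
    show ?thesis by (rule *[OF _ s(2)]) (use s in simp)
  qed
  moreover have "D z = z ^ N * q z" if "z \<in> ball 0 r" for z
  proof (cases "z \<in> ball 0 s")
    case True
    have "z ^ n = z ^ N * z ^ (n - N)" using \<open>N \<le> n\<close> by (simp flip: power_add)
    then show ?thesis using True Dg[OF True] by (simp add: q_def mult.assoc)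
  next
    case False
    then have "z \<noteq> 0" using s by auto
    then show ?thesis using False by (simp add: q_def)
  qed
  ultimately show ?thesis by auto
qed

lemma bc_lift_0_0:
  assumes "c \<notin> \<int>\<^sub>\<le>\<^sub>0"
  shows "bc_lift a b c 0 0 = 1"
  using hyp_lift_0[OF assms] by (simp add: bc_lift_def)

lemma bc_defect_0:
  assumes "c \<notin> \<int>\<^sub>\<le>\<^sub>0" "N > 0"
  shows "bc_defect a b c N 0 w = 0"
proof -
  have "(\<Sum>k<N. bc_coeff a b c k * (((1 - exp 0) * (1 - exp w)) ^ k * bc_lift a b c k (0 + w)))
    = (\<Sum>k<N. if k = 0 then bc_lift a b c 0 w else 0)"
    by (intro sum.cong refl) (auto simp: bc_coeff_def power_0_left)
  then show ?thesis
    using assms by (simp add: bc_defect_def bc_lift_0_0)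
qed

text \<open>The bound must be uniform in w before w can depend on z. For each fixed w the cofactor
  of z^N is bounded on the disc by its values on the circle |z| = e (maximum principle), and there
  the defect is bounded for all w near t by compactness.\<close>

lemma bc_defect_bound:
  assumes c: "c \<notin> \<int>\<^sub>\<le>\<^sub>0" and t: "t \<in> strip (2 * pi)" and N: "N > 0"
  shows "\<exists>C e. e > 0 \<and> (\<forall>z\<in>cball 0 e. norm (bc_defect a b c N z (t - z)) \<le> C * norm z ^ N)"
proof -
  \<comment> \<open>A quarter of the distance from t to the boundary of the strip: for |z| < 2e and
    |w - t| <= e the sum z + w moves by less than 3e from t.\<close>
  define e where "e = (2 * pi - \<bar>Im t\<bar>) / 4"
  have e: "e > 0" using t by (simp add: e_def strip_def)
  have z_strip: "z \<in> strip (2 * pi)" if "z \<in> ball 0 (2 * e)" for z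
    using that abs_Im_le_cmod[of z] abs_ge_zero[of "Im t"] by (auto simp: strip_def e_def)
  have w_strip: "w \<in> strip (2 * pi)" if "w \<in> cball t e" for w
    using that abs_Im_le_cmod[of "w - t"] e by (auto simp: strip_def e_def dist_norm norm_minus_commute)
  have zw_strip: "z + w \<in> strip (2 * pi)" if "z \<in> ball 0 (2 * e)" "w \<in> cball t e" for z w
    using that abs_Im_le_cmod[of z] abs_Im_le_cmod[of "w - t"] e
    by (auto simp: strip_def e_def dist_norm norm_minus_commute)
  note cont = holomorphic_on_imp_continuous_on[OF bc_lift_holomorphic[OF c]]
  have "continuous_on (cball 0 e \<times> cball t e) (\<lambda>p. bc_defect a b c N (fst p) (snd p))"
    unfolding bc_defect_def
    by (intro continuous_intros continuous_on_compose2[OF cont])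
      (use e z_strip w_strip zw_strip in \<open>auto simp: subset_eq\<close>)
  then have "bounded ((\<lambda>p. bc_defect a b c N (fst p) (snd p)) ` (cball 0 e \<times> cball t e))"
    by (intro compact_imp_bounded compact_continuous_image compact_Times) auto
  then obtain B where B: "\<And>z w. z \<in> cball 0 e \<Longrightarrow> w \<in> cball t e \<Longrightarrow> norm (bc_defect a b c N z w) \<le> B"
    by (force simp: bounded_iff)
  have "norm (bc_defect a b c N z w) \<le> B / e ^ N * norm z ^ N" if z: "z \<in> cball 0 e" and w: "w \<in> cball t e" for z w
  proof -
    have hol: "(\<lambda>z. bc_defect a b c N z w) holomorphic_on ball 0 (2 * e)"
    proof -
      have "(bc_lift a b c k \<circ> (\<lambda>z. z + w)) holomorphic_on ball 0 (2 * e)" for k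
        by (rule holomorphic_on_compose_gen[OF _ bc_lift_holomorphic[OF c]])
          (use zw_strip w in \<open>auto intro!: holomorphic_intros\<close>)
      moreover have "bc_lift a b c 0 holomorphic_on ball 0 (2 * e)"
        by (rule holomorphic_on_subset[OF bc_lift_holomorphic[OF c]]) (use z_strip in auto)
      ultimately show ?thesis
        unfolding bc_defect_def by (auto simp: o_def intro!: holomorphic_intros)
    qed
    \<comment> \<open>The removable singularity of (1 - exp z)/z filled in, so that z^(N - 1)
      factors exactly out of the power of XY.\<close>
    define \<kappa> where "\<kappa> z = (if z = 0 then - 1 else (1 - exp z) / z)" for z :: complex
    have \<kappa>: "isCont \<kappa> 0"
    proof -
      have "(\<kappa> \<longlongrightarrow> - 1) (at 0)"
        by (rule Lim_transform_within_open[OF tendsto_one_minus_exp_over open_UNIV]) (auto simp: \<kappa>_def)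
      then show ?thesis by (simp add: isCont_def \<kappa>_def)
    qed
    have exp\<kappa>: "1 - exp z = z * \<kappa> z" for z by (simp add: \<kappa>_def)
    define M where "M z = exp z * (1 - exp w) * (bc_coeff a b c N *
      ((of_nat N - 1 + c) * (of_nat N * (\<kappa> z * (1 - exp w)) ^ (N - 1)) * bc_lift a b c N (z + w)))" for z
    have "isCont (bc_lift a b c N) (0 + w)"
      using cont w_strip[OF w] by (simp add: continuous_on_eq_continuous_at)
    then have "isCont (\<lambda>z. bc_lift a b c N (z + w)) 0"
      by (rule isCont_o2[rotated]) (intro continuous_intros)
    then have M: "isCont M 0" unfolding M_def by (intro continuous_intros \<kappa>)
    have "\<exists>q. q holomorphic_on ball 0 (2 * e) \<and> (\<forall>z\<in>ball 0 (2 * e). bc_defect a b c N z w = z ^ N * q z)"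
    proof (rule hyp_op_vanishing_order[OF c hol _ bc_defect_0[OF c N] M])
      fix z :: complex assume z: "z \<in> ball 0 (2 * e)"
      show "hyp_op a b c (\<lambda>z. bc_defect a b c N z w) z = z ^ (N - 1) * M z"
        unfolding hyp_op_bc_defect[OF c z_strip[OF z] zw_strip[OF z w]] M_def exp\<kappa>
        by (simp add: power_mult_distrib mult_ac)
    qed (use e in simp)
    then obtain q where q: "q holomorphic_on ball 0 (2 * e)"
      "\<And>z. z \<in> ball 0 (2 * e) \<Longrightarrow> bc_defect a b c N z w = z ^ N * q z" by blast
    have "norm (q z) \<le> B / e ^ N"
    proof (rule maximum_modulus_frontier[of q "cball 0 e"])
      show "q holomorphic_on interior (cball 0 e)" "continuous_on (closure (cball 0 e)) q"
        using e by (auto intro!: holomorphic_on_imp_continuous_on intro: holomorphic_on_subset[OF q(1)])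
      fix z :: complex assume "z \<in> frontier (cball 0 e)"
      then have ze: "norm z = e" by simp
      then have "norm (bc_defect a b c N z w) \<le> B" using B[OF _ w, of z] by simp
      moreover have "bc_defect a b c N z w = z ^ N * q z" using q(2)[of z] ze e by simp
      ultimately show "norm (q z) \<le> B / e ^ N"
        using ze e by (simp add: norm_mult norm_power field_simps)
    qed (use z in auto)
    moreover have "bc_defect a b c N z w = z ^ N * q z" using q(2)[of z] z e by simp
    ultimately show ?thesis
      using mult_right_mono[of "norm (q z)" "B / e ^ N" "norm z ^ N"]
      by (simp add: norm_mult norm_power mult.commute)
  qed
  moreover have "t - z \<in> cball t e" if "z \<in> cball 0 e" for z using that by (simp add: dist_norm)
  ultimately show ?thesis using e by blast
qed

subsection \<open>Abel's limit theorem and the identity theorem in two variables\<close>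

text \<open>Summation by parts with the remainders \<open>r n\<close> of the partial sums: the power
  series minus its limit S equals (1 - t) times the series of r_n t^n. Late remainders are small,
  and early ones are killed by the factor 1 - t.\<close>

lemma Abel_limit:
  fixes a :: "nat \<Rightarrow> complex"
  assumes "summable a"
  shows "((\<lambda>t::real. \<Sum>n. a n * of_real t ^ n) \<longlongrightarrow> suminf a) (at_left 1)"
proof (rule tendstoI)
  fix e :: real assume e: "e > 0"
  define S where "S = suminf a"
  define r where "r n = (\<Sum>k\<le>n. a k) - S" for n
  have "r \<longlonglongrightarrow> S - S"
    unfolding r_def S_def by (intro tendsto_diff summable_LIMSEQ' assms tendsto_const)
  then have r0: "r \<longlonglongrightarrow> 0" by simp
  obtain N where N: "\<And>n. n \<ge> N \<Longrightarrow> norm (r n) \<le> e / 2"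
    using r0 e unfolding LIMSEQ_iff by (metis diff_zero half_gt_zero less_imp_le)
  \<comment> \<open>Bounds the contribution of the finitely many remainders before \<open>N\<close>,
    uniformly in t.\<close>
  define C where "C = (\<Sum>n<N. norm (r n))"
  have bound: "norm ((\<Sum>n. a n * of_real t ^ n) - S) \<le> (1 - t) * C + e / 2" if t: "0 \<le> t" "t < 1" for t
  proof -
    have "Bseq r" by (rule convergent_imp_Bseq[OF convergentI[OF r0]])
    then obtain K where K: "\<And>n. norm (r n) \<le> K" unfolding Bseq_def by blast
    have sn: "summable (\<lambda>n. norm (r n) * t ^ n)"
      by (rule summable_comparison_test[where g = "\<lambda>n. K * t ^ n"])
        (use t K in \<open>auto intro!: exI[of _ 0] mult_right_mono summable_mult simp: norm_mult norm_power\<close>)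
    have sr: "summable (\<lambda>n. r n * of_real t ^ n)"
      by (rule summable_norm_cancel) (use sn t in \<open>simp add: norm_mult norm_power\<close>)
    have sr': "summable (\<lambda>n. r (Suc n) * of_real t ^ Suc n)"
      using sr by (subst summable_Suc_iff)
    have "(\<lambda>n. r (Suc n) * of_real t ^ Suc n - of_real t * (r n * of_real t ^ n)) sums
        ((\<Sum>n. r (Suc n) * of_real t ^ Suc n) - of_real t * (\<Sum>n. r n * of_real t ^ n))"
      by (intro sums_diff sums_mult summable_sums sr sr')
    also have "(\<lambda>n. r (Suc n) * of_real t ^ Suc n - of_real t * (r n * of_real t ^ n))
        = (\<lambda>n. a (Suc n) * of_real t ^ Suc n)"
      by (auto simp: r_def algebra_simps)
    also have "(\<Sum>n. r (Suc n) * of_real t ^ Suc n) = (\<Sum>n. r n * of_real t ^ n) - r 0"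
      using suminf_split_head[OF sr] by simp
    finally have "(\<lambda>n. a n * of_real t ^ n) sums
        ((\<Sum>n. r n * of_real t ^ n) - r 0 - of_real t * (\<Sum>n. r n * of_real t ^ n) + a 0)"
      by (subst (asm) sums_Suc_iff) simp
    then have "(\<Sum>n. a n * of_real t ^ n) - S = (1 - of_real t) * (\<Sum>n. r n * of_real t ^ n)"
      by (simp add: sums_unique[symmetric] r_def algebra_simps)
    moreover have "norm (1 - complex_of_real t) = 1 - t"
      using norm_of_real[of "1 - t", where 'a = complex] t by simp
    ultimately have eq: "norm ((\<Sum>n. a n * of_real t ^ n) - S) = (1 - t) * norm (\<Sum>n. r n * of_real t ^ n)"
      by (simp add: norm_mult)
    have "norm (\<Sum>n. r n * of_real t ^ n) \<le> (\<Sum>n. norm (r n) * t ^ n)"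
      using summable_norm[of "\<lambda>n. r n * of_real t ^ n"] sn t by (simp add: norm_mult norm_power)
    also have "\<dots> = (\<Sum>n. norm (r (n + N)) * t ^ (n + N)) + (\<Sum>n<N. norm (r n) * t ^ n)"
      by (rule suminf_split_initial_segment[OF sn])
    also have "\<dots> \<le> (\<Sum>n. e / 2 * t ^ n) + C"
    proof (intro add_mono suminf_le)
      show "norm (r (n + N)) * t ^ (n + N) \<le> e / 2 * t ^ n" for n
        using t e by (intro mult_mono N power_decreasing) auto
      show "summable (\<lambda>n. norm (r (n + N)) * t ^ (n + N))" using sn by (subst summable_iff_shift)
      show "summable (\<lambda>n. e / 2 * t ^ n)" using t by (intro summable_mult summable_geometric) auto
      show "(\<Sum>n<N. norm (r n) * t ^ n) \<le> C"
        unfolding C_def using t by (intro sum_mono mult_left_le power_le_one) auto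
    qed
    also have "(\<Sum>n. e / 2 * t ^ n) = e / 2 / (1 - t)"
      using t by (subst suminf_mult) (auto simp: suminf_geometric)
    finally have "(1 - t) * norm (\<Sum>n. r n * of_real t ^ n) \<le> (1 - t) * (e / 2 / (1 - t) + C)"
      using t by (intro mult_left_mono) auto
    also have "(1 - t) * (e / 2 / (1 - t) + C) = (1 - t) * (e / 2 / (1 - t)) + (1 - t) * C"
      by (rule distrib_left)
    also have "(1 - t) * (e / 2 / (1 - t)) = e / 2" 
      using t by (metis diff_gt_0_iff_gt less_irrefl nonzero_mult_div_cancel_left times_divide_eq_right)
    finally show ?thesis unfolding eq by (simp add: add.commute)
  qed
  have "((\<lambda>t. (1 - t) * C + e / 2) \<longlongrightarrow> (1 - 1) * C + e / 2) (at_left (1::real))"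
    by (intro tendsto_intros)
  then have "eventually (\<lambda>t. (1 - t) * C + e / 2 < e) (at_left (1::real))"
    by (rule order_tendstoD) (use e in simp)
  moreover have "eventually (\<lambda>t. t \<in> {0<..<1}) (at_left (1::real))"
    by (rule eventually_at_leftI[of 0]) auto
  ultimately show "eventually (\<lambda>t. dist (\<Sum>n. a n * of_real t ^ n) (suminf a) < e) (at_left 1)"
  proof eventually_elim
    case (elim t)
    then show ?case using bound[of t] by (simp add: dist_norm S_def)
  qed
qed

text \<open>Weaker than \<open>holomorphic2_on\<close>, but enough for an identity theorem assembled
  from the one-variable theorem, and easy to check for explicit expressions.\<close>

definition separately_holomorphic_on :: "(complex \<times> complex \<Rightarrow> complex) \<Rightarrow> (complex \<times> complex) set \<Rightarrow> bool" where
  "separately_holomorphic_on f U \<longleftrightarrow> (\<forall>(u, v)\<in>U.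
     (\<lambda>z. f (z, v)) field_differentiable at u \<and> (\<lambda>w. f (u, w)) field_differentiable at v)"

lemma separately_holomorphic_identity_box:
  assumes f: "separately_holomorphic_on f (A \<times> B)" and A: "open A" "connected A" and B: "open B" "connected B"
    and S: "S \<subseteq> A" "s \<in> A" "s islimpt S" and T: "T \<subseteq> B" "t \<in> B" "t islimpt T"
    and 0: "\<And>u v. u \<in> S \<Longrightarrow> v \<in> T \<Longrightarrow> f (u, v) = 0" and uv: "u \<in> A" "v \<in> B"
  shows "f (u, v) = 0"
proof -
  have h1: "(\<lambda>w. f (u, w)) holomorphic_on B" if "u \<in> A" for u
    using f that by (auto simp: separately_holomorphic_on_def holomorphic_on_def field_differentiable_at_within)
  have h2: "(\<lambda>z. f (z, v)) holomorphic_on A" if "v \<in> B" for v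
    using f that by (auto simp: separately_holomorphic_on_def holomorphic_on_def field_differentiable_at_within)
  have "f (u, v) = 0" if "u \<in> S" for u
    by (rule analytic_continuation[of "\<lambda>w. f (u, w)" B T t v]) (use that h1 B S T 0 uv in auto)
  then show ?thesis
    by (intro analytic_continuation[of "\<lambda>z. f (z, v)" A S s u]) (use h2 A S uv in auto)
qed

text \<open>Tailored to \<open>basic_range\<close>, which has empty interior in two complex
  variables: vanishing on a product of two sets with limit points first gives vanishing on a box,
  applying the one-variable theorem once in each variable.\<close>

lemma separately_holomorphic_identity:
  assumes f: "separately_holomorphic_on f U" and U: "open U" "connected U"
    and ST: "S \<times> T \<subseteq> U" "s \<in> S" "s islimpt S" "t \<in> T" "t islimpt T"
    and 0: "\<And>u v. u \<in> S \<Longrightarrow> v \<in> T \<Longrightarrow> f (u, v) = 0" and p: "p \<in> U"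
  shows "f p = 0"
proof -
  have box: "\<exists>A B. a \<in> A \<times> B \<and> A \<times> B \<subseteq> U \<and> open A \<and> open B \<and> connected A \<and> connected B" if aU: "a \<in> U" for a
  proof -
    obtain A B where AB: "open A" "open B" "a \<in> A \<times> B" "A \<times> B \<subseteq> U"
      by (rule open_prod_elim[OF U(1) aU])
    obtain d e where "d > 0" "ball (fst a) d \<subseteq> A" "e > 0" "ball (snd a) e \<subseteq> B"
      using AB by (metis mem_Times_iff open_contains_ball)
    then show ?thesis
      using AB by (intro exI[of _ "ball (fst a) d"] exI[of _ "ball (snd a) e"]) (auto simp: mem_Times_iff)
  qed
  have sub: "separately_holomorphic_on f V" if "V \<subseteq> U" for V
    using f that by (auto simp: separately_holomorphic_on_def)
  \<comment> \<open>Vanishing near the point, rather than at it, is what passes from box to box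
    along the connected domain.\<close>
  define P where "P = (\<lambda>q. eventually (\<lambda>q. f q = 0) (nhds q))"
  have "P p"
  proof (rule connected_induction_simple[OF U(2)])
    show st: "(s, t) \<in> U" using ST by auto
    obtain A B where AB: "(s, t) \<in> A \<times> B" "A \<times> B \<subseteq> U" "open A" "open B" "connected A" "connected B"
      using box[OF st] by (elim exE conjE) (rule that)
    have "s islimpt (S \<inter> A)" "t islimpt (T \<inter> B)"
      using AB by (intro islimpt_Int_eventually ST eventually_at_in_open'; simp)+
    then have "f q = 0" if "q \<in> A \<times> B" for q
      using separately_holomorphic_identity_box[OF sub[OF AB(2)] AB(3,5,4,6), of "S \<inter> A" s "T \<inter> B" t "fst q" "snd q"]
        AB 0 that by auto
    then show "P (s, t)"
      unfolding P_def eventually_nhds using AB by (intro exI[of _ "A \<times> B"]) (auto intro: open_Times)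
    show "p \<in> U" by fact
    fix a assume a: "a \<in> U"
    obtain A B where AB: "a \<in> A \<times> B" "A \<times> B \<subseteq> U" "open A" "open B" "connected A" "connected B"
      using box[OF a] by (elim exE conjE) (rule that)
    have "P y" if xy: "x \<in> A \<times> B" "y \<in> A \<times> B" "P x" for x y
    proof -
      obtain V where V: "open V" "x \<in> V" "\<And>q. q \<in> V \<Longrightarrow> f q = 0"
        using xy unfolding P_def eventually_nhds by blast
      obtain C D where CD: "open C" "open D" "x \<in> C \<times> D" "C \<times> D \<subseteq> V"
        by (rule open_prod_elim[OF V(1,2)])
      have "fst x islimpt (C \<inter> A)" "snd x islimpt (D \<inter> B)"
        using CD AB xy by (auto intro!: interior_limit_point simp: interior_open open_Int)
      moreover have "f (u, v) = 0" if "u \<in> C \<inter> A" "v \<in> D \<inter> B" for u v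
        using that CD(4) V(3) by blast
      ultimately have "f q = 0" if "q \<in> A \<times> B" for q
        using separately_holomorphic_identity_box[OF sub[OF AB(2)] AB(3,5,4,6), of "C \<inter> A" "fst x" "D \<inter> B" "snd x" "fst q" "snd q"]
          xy that by (auto simp: mem_Times_iff)
      then show ?thesis
        unfolding P_def eventually_nhds using AB xy by (intro exI[of _ "A \<times> B"]) (auto intro: open_Times)
    qed
    moreover have "openin (top_of_set U) (A \<times> B)"
      by (rule open_subset[OF AB(2) open_Times[OF AB(3,4)]])
    ultimately show "\<exists>T. openin (top_of_set U) T \<and> a \<in> T \<and> (\<forall>x\<in>T. \<forall>y\<in>T. P x \<longrightarrow> P y)"
      using AB(1) by (intro exI[of _ "A \<times> B"] conjI ballI impI)
  qed
  then show ?thesis unfolding P_def by (rule eventually_nhds_x_imp_x)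
qed

subsection \<open>Continuation along a segment\<close>

text \<open>\<open>Arccos\<close> supplies a preimage w of cos with |Re w| <= pi. The boundary lines
  are excluded because cos maps them into the forbidden ray, with values - cosh(Im w).\<close>

lemma cosh_strip_surj:
  assumes "\<And>x. x \<le> -1 \<Longrightarrow> q \<noteq> complex_of_real x"
  obtains z where "z \<in> strip pi" "cosh z = q"
proof
  define w where "w = Arccos q"
  have w: "cos w = q" by (simp add: w_def)
  have cosh: "cosh (\<i> * w) = cos w" by (simp add: cosh_field_def cos_exp_eq)
  show "cosh (\<i> * w) = q" using w cosh by simp
  have "\<bar>Re w\<bar> \<le> pi" unfolding w_def by (rule Re_Arccos_bound)
  moreover have "\<bar>Re w\<bar> \<noteq> pi"
  proof
    assume R: "\<bar>Re w\<bar> = pi"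
    then have "Re w = pi \<or> Re w = - pi" by linarith
    then have cs: "cos (Re w) = -1" "sin (Re w) = 0" by auto
    have "q = complex_of_real (- cosh (Im w))"
      unfolding w[symmetric] by (rule complex_eqI) (simp_all add: Re_cos Im_cos cs cosh_field_def field_simps)
    moreover have "- cosh (Im w) \<le> -1" using cosh_real_ge_1[of "Im w"] by simp
    ultimately show False using assms by blast
  qed
  ultimately show "\<i> * w \<in> strip pi" by (simp add: strip_def)
qed

text \<open>A point therefore has at most two lifts, opposite to each other; an even function cannot
  distinguish them.\<close>

lemma cosh_eq_strip:
  fixes x y :: complex
  assumes "cosh x = cosh y" "x \<in> strip pi" "y \<in> strip pi"
  shows "x = y \<or> x = - y"
proof -
  have "exp x * exp y * (2 * cosh x - 2 * cosh y) = (exp x - exp y) * (exp x * exp y - 1)"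
    by (simp add: cosh_field_def exp_minus field_simps)
  then have "exp x = exp y \<or> exp x * exp y = 1" using assms(1) by simp
  then have "exp x = exp y \<or> exp x = exp (- y)" by (auto simp: exp_minus field_simps)
  moreover have "\<bar>Im x - Im y\<bar> < 2 * pi" "\<bar>Im x - Im (- y)\<bar> < 2 * pi"
    using assms(2,3) by (auto simp: strip_def)
  ultimately show ?thesis using exp_complex_eqI by blast
qed

text \<open>Openness holds at the critical points of cosh too, so nearby values have nearby lifts
  even where cosh has no local inverse.\<close>

lemma open_cosh_image:
  assumes "open (N :: complex set)"
  shows "open (cosh ` N)"
proof (rule open_mapping_thm[of cosh UNIV])
  show "(cosh :: complex \<Rightarrow> complex) holomorphic_on UNIV"
    unfolding cosh_field_def by (intro holomorphic_intros) simp
  show "\<not> (cosh :: complex \<Rightarrow> complex) constant_on UNIV"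
  proof
    assume "(cosh :: complex \<Rightarrow> complex) constant_on UNIV"
    then have "cosh (\<i> * pi) = cosh (0 :: complex)" by (metis UNIV_I constant_on_def)
    then show False by (simp add: cosh_field_def exp_minus)
  qed
qed (use assms in auto)

lemma Re_cosh_complex: "Re (cosh z) = cosh (Re z) * cos (Im z)"
  by (simp add: cosh_field_def Re_exp algebra_simps)

text \<open>For fixed $z_1 + z_2 = 2T$ and $z_1 - z_2 = 2\zeta$ the product $XY$ is an affine function of $\cosh\zeta$, and
  $\cosh$ maps the strip $|{\rm Im}\,\zeta| < \pi$ onto the complement of $(-\infty,-1]$.\<close>

lemma cosh_segment_avoids_cut:
  fixes T \<zeta> :: complex and \<tau> x :: real
  assumes "\<bar>Im T\<bar> + \<bar>Im \<zeta>\<bar> < pi" "0 \<le> \<tau>" "\<tau> \<le> 1" "x \<le> -1"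
  shows "cosh T + of_real \<tau> * (cosh \<zeta> - cosh T) \<noteq> of_real x"
proof
  assume eq: "cosh T + of_real \<tau> * (cosh \<zeta> - cosh T) = of_real x"
  \<comment> \<open>In half arguments cosh z = 2 cosh(z/2)^2 - 1, so a real value <= -1 on the
    segment means that a convex combination of P^2 and Q^2 is real and <= 0. P and Q lie in the
    right half-plane at an angle less than pi/2 to each other, so the cone spanned by P^2 and Q^2
    misses that ray.\<close>
  define P Q where "P = cosh (T / 2)" and "Q = cosh (\<zeta> / 2)"
  have dbl: "cosh z = 2 * cosh (z / 2) ^ 2 - 1" for z :: complex
  proof -
    have "exp z = exp (z / 2) * exp (z / 2)" by (simp flip: exp_add)
    then show ?thesis by (simp add: cosh_field_def exp_minus field_simps power2_eq_square)
  qed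
  have pos: "Re (cosh z) > 0" if "\<bar>Im z\<bar> < pi / 2" for z
    unfolding Re_cosh_complex using that cosh_real_pos[of "Re z"] by (auto intro!: mult_pos_pos cos_gt_zero_pi)
  have PQ: "Re P > 0" "Re Q > 0" unfolding P_def Q_def using assms(1) by (auto intro!: pos)
  \<comment> \<open>The angle between P and Q is controlled by a product-to-sum formula. Conjugating
    \<zeta> flips the sign of its imaginary part, which the bound on |Im T| + |Im \<zeta>|
    tolerates.\<close>
  have PQeq: "P * cnj Q = (cosh ((T + cnj \<zeta>) / 2) + cosh ((T - cnj \<zeta>) / 2)) / 2"
  proof -
    have "cnj Q = cosh (cnj \<zeta> / 2)" by (simp add: Q_def cosh_field_def exp_cnj)
    then show ?thesis
      by (simp add: P_def cosh_add cosh_diff add_divide_distrib diff_divide_distrib)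
  qed
  have "Re (cosh ((T + cnj \<zeta>) / 2)) > 0" "Re (cosh ((T - cnj \<zeta>) / 2)) > 0"
    using assms(1) by (auto intro!: pos)
  then have "Re (P * cnj Q) > 0" unfolding PQeq by simp
  then have PQ': "Re P * Re Q + Im P * Im Q > 0" by simp
  define \<alpha> where "\<alpha> = 1 - \<tau>"
  have \<alpha>: "\<alpha> \<ge> 0" "\<tau> = 1 - \<alpha>" using assms by (simp_all add: \<alpha>_def)
  have "2 * (of_real \<alpha> * P\<^sup>2 + of_real \<tau> * Q\<^sup>2) = complex_of_real (x + 1)"
    using eq dbl[of T] dbl[of \<zeta>] unfolding \<alpha>(2) P_def[symmetric] Q_def[symmetric] by (simp add: algebra_simps)
  then have eq': "of_real \<alpha> * P\<^sup>2 + of_real \<tau> * Q\<^sup>2 = complex_of_real ((x + 1) / 2)"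
    by (simp add: field_simps)
  have re: "\<alpha> * (Re P * Re P - Im P * Im P) + \<tau> * (Re Q * Re Q - Im Q * Im Q) \<le> 0"
    using arg_cong[OF eq', of Re] assms by (simp add: power2_eq_square)
  have im: "\<alpha> * (Re P * Im P) + \<tau> * (Re Q * Im Q) = 0"
    using arg_cong[OF eq', of Im] by (simp add: power2_eq_square algebra_simps)
  \<comment> \<open>Written so that the imaginary part of the combination appears as a factor of the
    last term; that factor is 0, and what remains is positive.\<close>
  have "(Re P * Re Q) * (\<alpha> * (Re P * Re P - Im P * Im P) + \<tau> * (Re Q * Re Q - Im Q * Im Q))
    = (\<alpha> * (Re P * Re P) + \<tau> * (Re Q * Re Q)) * (Re P * Re Q + Im P * Im Q)
      - (\<alpha> * (Re P * Im P) + \<tau> * (Re Q * Im Q)) * (Im P * Re Q + Re P * Im Q)"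
    by (simp add: algebra_simps)
  also have "\<dots> = (\<alpha> * (Re P * Re P) + \<tau> * (Re Q * Re Q)) * (Re P * Re Q + Im P * Im Q)"
    unfolding im by simp
  also have "\<dots> > 0"
  proof (rule mult_pos_pos[OF _ PQ'])
    have "Re P * Re P > 0" "Re Q * Re Q > 0" using PQ by auto
    then show "\<alpha> * (Re P * Re P) + \<tau> * (Re Q * Re Q) > 0"
      using \<alpha> assms(2) by (cases "\<tau> = 0") (auto intro!: add_nonneg_pos)
  qed
  finally have "(Re P * Re Q) * (\<alpha> * (Re P * Re P - Im P * Im P) + \<tau> * (Re Q * Re Q - Im Q * Im Q)) > 0" .
  moreover have "(Re P * Re Q) * (\<alpha> * (Re P * Re P - Im P * Im P) + \<tau> * (Re Q * Re Q - Im Q * Im Q)) \<le> 0"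
    by (rule mult_nonneg_nonpos[OF _ re]) (use PQ in simp)
  ultimately show False by simp
qed

section \<open>Flatness at the origin and the expansion near it\<close>

lemma power_series_tail_bigo:
  fixes S :: "nat \<Rightarrow> complex"
  assumes r: "r > 0" "ereal r \<le> conv_radius S" and h: "(h \<longlongrightarrow> 0) (at 0)"
  shows "(\<lambda>z. (\<Sum>k. S k * h z ^ k) - (\<Sum>k<N. S k * h z ^ k)) \<in> O[at 0](\<lambda>z. h z ^ N)"
proof -
  define F where "F = Abs_fps (\<lambda>k. S (k + N))"
  have "conv_radius (\<lambda>k. S (k + N)) = conv_radius S"
    by (rule conv_radius_shift)
  then have F: "fps_conv_radius F \<ge> ereal r" using r by (simp add: F_def fps_conv_radius_def)
  have "eventually (\<lambda>z. norm (h z) < r) (at 0)"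
    using tendsto_norm_zero[OF h] r(1) by (rule order_tendstoD)
  then have "eventually (\<lambda>z. (\<Sum>k. S k * h z ^ k) - (\<Sum>k<N. S k * h z ^ k) = h z ^ N * eval_fps F (h z)) (at 0)"
  proof eventually_elim
    case (elim z)
    have sm: "summable (\<lambda>k. S k * h z ^ k)"
      by (rule summable_in_conv_radius) (use elim r(2) less_le_trans[of "ereal (norm (h z))" "ereal r" "conv_radius S"] in simp)
    have sm': "summable (\<lambda>k. S (k + N) * h z ^ k)"
      using summable_fps[of "h z" F] less_le_trans[of "ereal (norm (h z))" "ereal r"] elim F by (simp add: F_def)
    have "(\<Sum>k. S k * h z ^ k) - (\<Sum>k<N. S k * h z ^ k) = (\<Sum>k. S (k + N) * h z ^ (k + N))"
      using suminf_split_initial_segment[OF sm, of N] by simp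
    also have "\<dots> = (\<Sum>k. h z ^ N * (S (k + N) * h z ^ k))" by (simp add: power_add mult_ac)
    also have "\<dots> = h z ^ N * (\<Sum>k. S (k + N) * h z ^ k)" by (rule suminf_mult[OF sm'])
    finally show ?case by (simp add: eval_fps_def F_def)
  qed
  moreover have "(\<lambda>z. h z ^ N * eval_fps F (h z)) \<in> O[at 0](\<lambda>z. h z ^ N * 1)"
  proof (rule landau_o.big.mult[OF landau_o.big_refl])
    have "isCont (eval_fps F) 0"
      using F r(1) by (intro continuous_eval_fps) (auto intro: less_le_trans[of _ "ereal r"])
    then have "((\<lambda>z. eval_fps F (h z)) \<longlongrightarrow> eval_fps F 0) (at 0)"
      using h by (rule isCont_tendsto_compose)
    then show "(\<lambda>z. eval_fps F (h z)) \<in> O[at 0](\<lambda>_. 1)"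
      by (intro bigoI_tendsto[where c = "eval_fps F 0"]) auto
  qed
  ultimately show ?thesis by (simp add: landau_o.big.in_cong)
qed

text \<open>A nonconstant function vanishing at 0 has a zero of some finite order n there; the bound
  for n + 1 would force its nonvanishing cofactor to be 0 at 0.\<close>

lemma holomorphic_eq_0_if_bigo_powers:
  assumes f: "f holomorphic_on ball 0 r" "r > 0" and O: "\<And>N. N > 0 \<Longrightarrow> f \<in> O[at 0](\<lambda>z::complex. z ^ N)"
    and f0: "f 0 = 0" and z: "z \<in> ball 0 r"
  shows "f z = 0"
proof (cases "f constant_on ball 0 r")
  case True
  then show ?thesis using f0 z f(2) by (auto simp: constant_on_def)
next
  case False
  have r0: "0 \<in> ball 0 r" using f by simp
  obtain g s n where n: "n > 0" and s: "s > 0" and g: "g holomorphic_on ball 0 s"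
    and fg: "\<And>z. z \<in> ball 0 s \<Longrightarrow> f z = z ^ n * g z" and g0: "\<And>z. z \<in> ball 0 s \<Longrightarrow> g z \<noteq> 0"
    by (rule holomorphic_factor_zero_nonconstant[OF f(1) open_ball connected_ball r0 f0 False], rule that; simp)
  have ev: "eventually (\<lambda>z. z \<in> ball 0 s - {0}) (at 0)"
    using eventually_at_in_open[OF open_ball, of 0 0 s] s by simp
  obtain C where C: "C > 0" "eventually (\<lambda>z. norm (f z) \<le> C * norm (z ^ Suc n)) (at 0)"
    using landau_o.bigE[OF O[of "Suc n"]] by auto
  have "eventually (\<lambda>z. norm (g z) \<le> C * norm z) (at 0)"
    using ev C(2)
  proof eventually_elim
    case (elim z)
    have "norm z ^ n * norm (g z) \<le> norm z ^ n * (C * norm z)"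
      using elim fg[of z] by (simp add: norm_mult norm_power mult_ac)
    then show ?case using elim by (subst (asm) mult_le_cancel_left_pos) auto
  qed
  moreover have "((\<lambda>z::complex. C * norm z) \<longlongrightarrow> C * norm (0 :: complex)) (at 0)" by (intro tendsto_intros)
  ultimately have "(g \<longlongrightarrow> 0) (at 0)" by (intro Lim_null_comparison[of g "\<lambda>z. C * norm z"]) auto
  moreover have "(g \<longlongrightarrow> g 0) (at 0)"
    using g s by (auto dest!: holomorphic_on_imp_continuous_on simp: continuous_on_eq_continuous_at isCont_def)
  ultimately have "g 0 = 0" by (rule tendsto_unique[OF trivial_limit_at, rotated])
  then show ?thesis using g0[of 0] s by simp
qed

text \<open>Product minus series is, for every N, the defect minus the tail of the series. Both are
  O(z^N), as XY is O(z) for fixed t, so the difference is flat at 0. Positivity of the radius of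
  convergence suffices.\<close>

lemma bc_series_near_0:
  assumes c: "c \<notin> \<int>\<^sub>\<le>\<^sub>0" and t: "t \<in> strip (2 * pi)"
    and r: "r > 0" "ereal r \<le> conv_radius (\<lambda>k. bc_coeff a b c k * bc_lift a b c k t)"
  shows "eventually (\<lambda>z. (\<Sum>k. bc_coeff a b c k * bc_lift a b c k t * ((1 - exp z) * (1 - exp (t - z))) ^ k)
     = bc_lift a b c 0 z * bc_lift a b c 0 (t - z)) (nhds 0)"
proof -
  define S where "S k = bc_coeff a b c k * bc_lift a b c k t" for k
  define h where "h z = (1 - exp z) * (1 - exp (t - z))" for z
  define F where "F = Abs_fps S"
  define f where "f z = bc_lift a b c 0 z * bc_lift a b c 0 (t - z) - eval_fps F (h z)" for z
  have F: "fps_conv_radius F \<ge> ereal r" using r by (simp add: F_def fps_conv_radius_def S_def)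
  have hcont: "continuous_on UNIV h" unfolding h_def by (intro continuous_intros)
  define V where "V = {z. z \<in> strip (2 * pi) \<and> t - z \<in> strip (2 * pi) \<and> norm (h z) < r}"
  have V: "open V" "0 \<in> V"
    using t r unfolding V_def strip_def h_def
    by (auto intro!: open_Collect_less open_Collect_conj continuous_intros)
  obtain e where e: "e > 0" "ball 0 e \<subseteq> V" using V by (meson open_contains_ball)
  have hol: "f holomorphic_on ball 0 e"
  proof -
    have "(bc_lift a b c 0 \<circ> (\<lambda>z. t - z)) holomorphic_on V"
      by (rule holomorphic_on_compose_gen[OF _ bc_lift_holomorphic[OF c]]) (auto simp: V_def intro!: holomorphic_intros)
    moreover have "bc_lift a b c 0 holomorphic_on V"
      by (rule holomorphic_on_subset[OF bc_lift_holomorphic[OF c]]) (auto simp: V_def)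
    moreover have "(eval_fps F \<circ> h) holomorphic_on V"
    proof (rule holomorphic_on_compose_gen[where t = "eball 0 (fps_conv_radius F)"])
      show "h holomorphic_on V" unfolding h_def by (intro holomorphic_intros)
      show "h ` V \<subseteq> eball 0 (fps_conv_radius F)"
        using F less_le_trans[of "ereal (norm (h _))" "ereal r"] by (auto simp: V_def in_eball_iff)
    qed (intro holomorphic_on_eval_fps order_refl)
    ultimately have "f holomorphic_on V" unfolding f_def by (auto simp: o_def intro!: holomorphic_intros)
    then show ?thesis using e(2) by (rule holomorphic_on_subset)
  qed
  have h0: "(h \<longlongrightarrow> 0) (at 0)"
  proof -
    have "isCont h 0" using hcont by (simp add: continuous_on_eq_continuous_at)
    moreover have "h 0 = 0" by (simp add: h_def)
    ultimately show ?thesis by (simp add: isCont_def)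
  qed
  have hz: "h \<in> O[at 0](\<lambda>z. z)"
  proof (rule bigoI_tendsto[where c = "(- 1) * (1 - exp (t - 0))"])
    have "((\<lambda>z. ((1 - exp z) / z) * (1 - exp (t - z))) \<longlongrightarrow> (- 1) * (1 - exp (t - 0))) (at 0)"
      by (intro tendsto_intros tendsto_one_minus_exp_over)
    then show "((\<lambda>z. h z / z) \<longlongrightarrow> (- 1) * (1 - exp (t - 0))) (at 0)" by (simp add: h_def)
  qed (simp add: eventually_at_filter)
  have O: "f \<in> O[at 0](\<lambda>z. z ^ N)" if N: "N > 0" for N
  proof -
    have "f = (\<lambda>z. bc_defect a b c N z (t - z) - ((\<Sum>k. S k * h z ^ k) - (\<Sum>k<N. S k * h z ^ k)))"
      by (rule ext) (simp add: f_def bc_defect_def eval_fps_def F_def h_def S_def mult_ac)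
    moreover have "(\<lambda>z. bc_defect a b c N z (t - z)) \<in> O[at 0](\<lambda>z. z ^ N)"
    proof -
      obtain C d where d: "d > 0" "\<forall>z\<in>cball 0 d. norm (bc_defect a b c N z (t - z)) \<le> C * norm z ^ N"
        using bc_defect_bound[OF c t N] by blast
      have "eventually (\<lambda>z. z \<in> ball 0 d) (at (0::complex))"
        using d by (intro eventually_at_in_open') auto
      then show ?thesis
        by (intro bigoI[where c = C]) (auto elim!: eventually_mono simp: norm_power d(2))
    qed
    moreover have "(\<lambda>z. (\<Sum>k. S k * h z ^ k) - (\<Sum>k<N. S k * h z ^ k)) \<in> O[at 0](\<lambda>z. z ^ N)"
      by (rule landau_o.big_trans[OF power_series_tail_bigo[OF r(1) _ h0] landau_o.big_power[OF hz]])
        (use r(2) in \<open>simp add: S_def\<close>)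
    ultimately show ?thesis by (simp add: sum_in_bigo)
  qed
  have "eval_fps F 0 = S 0" by (simp add: eval_fps_at_0 F_def)
  then have "f 0 = 0"
    using bc_lift_0_0[OF c] by (simp add: f_def h_def S_def bc_coeff_def)
  then have "f z = 0" if "z \<in> ball 0 e" for z
    using holomorphic_eq_0_if_bigo_powers[OF hol e(1) O _ that] by simp
  then have "eventually (\<lambda>z. f z = 0) (nhds 0)"
    using eventually_nhds_in_open[OF open_ball, of 0 0 e] e by (auto elim!: eventually_mono)
  then show ?thesis
    by eventually_elim (simp add: f_def eval_fps_def F_def S_def h_def)
qed

text \<open>The series side lives in the variable cosh w, the product side in w itself, where z1 = T
  + w and z2 = T - w. The two are compared on the strip, whereas the induction runs along a segment
  of values of cosh. A nonzero XY at the given point guarantees a positive radius of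
  convergence.\<close>

lemma bc_sum:
  assumes c: "c \<notin> \<int>\<^sub>\<le>\<^sub>0" and z1: "z1 \<in> strip pi" and z2: "z2 \<in> strip pi"
    and nz: "(1 - exp z1) * (1 - exp z2) \<noteq> 0"
    and sm: "summable (\<lambda>k. bc_coeff a b c k * bc_lift a b c k (z1 + z2) * ((1 - exp z1) * (1 - exp z2)) ^ k)"
  shows "(\<Sum>k. bc_coeff a b c k * bc_lift a b c k (z1 + z2) * ((1 - exp z1) * (1 - exp z2)) ^ k)
    = bc_lift a b c 0 z1 * bc_lift a b c 0 z2"
proof -
  define t T \<zeta> where "t = z1 + z2" and "T = t / 2" and "\<zeta> = (z1 - z2) / 2"
  have z12: "z1 = T + \<zeta>" "z2 = T - \<zeta>" "t = 2 * T" by (simp_all add: t_def T_def \<zeta>_def field_simps)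
  have im: "\<bar>Im T\<bar> + \<bar>Im \<zeta>\<bar> < pi"
  proof -
    have "2 * Im T = Im z1 + Im z2" "2 * Im \<zeta> = Im z1 - Im z2" "\<bar>Im z1\<bar> < pi" "\<bar>Im z2\<bar> < pi"
      using z1 z2 by (simp_all add: T_def t_def \<zeta>_def strip_def)
    then show ?thesis by linarith
  qed
  have T: "T \<in> strip pi" and \<zeta>: "\<zeta> \<in> strip pi" and t: "t \<in> strip (2 * pi)"
    using im by (auto simp: strip_def z12(3))
  define S where "S k = bc_coeff a b c k * bc_lift a b c k t" for k
  define x0 where "x0 = (1 - exp z1) * (1 - exp z2)"
  define r where "r = norm x0"
  have r: "r > 0" using nz by (simp add: r_def x0_def)
  have sm': "summable (\<lambda>k. S k * x0 ^ k)" using sm by (simp add: S_def t_def x0_def)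
  then have rS: "ereal r \<le> conv_radius S" unfolding r_def by (rule conv_radius_geI)
  define F where "F = Abs_fps S"
  have F: "fps_conv_radius F \<ge> ereal r" using rS by (simp add: F_def fps_conv_radius_def)
  define \<theta> where "\<theta> = eval_fps F"
  have \<theta>: "\<theta> x = (\<Sum>k. S k * x ^ k)" for x by (simp add: \<theta>_def eval_fps_def F_def)
  define q0 q1 where "q0 = cosh T" and "q1 = cosh \<zeta>"
  \<comment> \<open>XY as an affine function of cosh w; it is 0 at cosh T and the given product at
    cosh \<zeta>, so the segment between these values is a radius of the disc of
    convergence.\<close>
  define A where "A q = 1 + exp t - 2 * exp T * q" for q :: complex
  have et: "exp t = exp T * exp T" unfolding z12(3) by (simp flip: exp_add)
  have A: "(1 - exp (T + w)) * (1 - exp (T - w)) = A (cosh w)" for w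
    by (simp add: A_def et cosh_field_def exp_add exp_diff exp_minus field_simps)
  have A0: "A q0 = 0" using A[of T] by (simp add: q0_def)
  have A1: "A q1 = x0" using A[of \<zeta>] by (simp add: q1_def x0_def z12)
  define f where "f w = bc_lift a b c 0 (T + w) * bc_lift a b c 0 (T - w)" for w
  define g where "g w = f w - \<theta> (A (cosh w))" for w
  have geven: "g (- w) = g w" for w by (simp add: g_def f_def mult.commute)
  define V where "V = {w. w \<in> strip pi \<and> norm (A (cosh w)) < r}"
  have f_hol: "f holomorphic_on strip pi"
  proof -
    have "(bc_lift a b c 0 \<circ> (\<lambda>w. T + w)) holomorphic_on strip pi" "(bc_lift a b c 0 \<circ> (\<lambda>w. T - w)) holomorphic_on strip pi"
      by (rule holomorphic_on_compose_gen[OF _ bc_lift_holomorphic[OF c]];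
          use T in \<open>auto simp: strip_def intro!: holomorphic_intros\<close>)+
    then show ?thesis unfolding f_def by (auto simp: o_def intro!: holomorphic_intros)
  qed
  have V: "open V"
    unfolding V_def strip_def A_def cosh_field_def by (auto intro!: open_Collect_less open_Collect_conj continuous_intros)
  have g_hol: "g holomorphic_on V"
  proof -
    have "(\<theta> \<circ> (\<lambda>w. A (cosh w))) holomorphic_on V"
    proof (rule holomorphic_on_compose_gen[where t = "eball 0 (fps_conv_radius F)"])
      show "(\<lambda>w. A (cosh w)) holomorphic_on V"
        unfolding A_def cosh_field_def by (intro holomorphic_intros) auto
      show "(\<lambda>w. A (cosh w)) ` V \<subseteq> eball 0 (fps_conv_radius F)"
        using F less_le_trans[of "ereal (norm (A (cosh _)))" "ereal r"] by (auto simp: V_def in_eball_iff)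
      show "\<theta> holomorphic_on eball 0 (fps_conv_radius F)"
        unfolding \<theta>_def by (intro holomorphic_on_eval_fps order_refl)
    qed
    moreover have "f holomorphic_on V" by (rule holomorphic_on_subset[OF f_hol]) (auto simp: V_def)
    ultimately show ?thesis unfolding g_def by (auto simp: o_def intro!: holomorphic_intros)
  qed
  \<comment> \<open>Quantifying over all lifts makes this a statement about the value q. It costs
    nothing: by evenness of \<open>g\<close> one lift decides for both.\<close>
  define P where "P q \<longleftrightarrow> (\<forall>w\<in>strip pi. cosh w = q \<longrightarrow> eventually (\<lambda>w. g w = 0) (nhds w))" for q
  have flip: "eventually (\<lambda>w. g w = 0) (nhds (- w))" if "eventually (\<lambda>w. g w = 0) (nhds w)" for w
  proof -
    have "filterlim uminus (nhds (- (- w))) (nhds (- w))" by (intro tendsto_intros tendsto_ident_at filterlim_ident)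
    then have "eventually (\<lambda>w. g (- w) = 0) (nhds (- w))"
      using eventually_compose_filterlim[OF that] by simp
    then show ?thesis by (simp add: geven)
  qed
  have PI: "P (cosh w)" if "w \<in> strip pi" "eventually (\<lambda>w. g w = 0) (nhds w)" for w
    unfolding P_def using cosh_eq_strip[OF _ _ that(1)] that(2) flip by metis
  \<comment> \<open>At w = - T the first factor has argument T + w = 0, the centre of the local
    expansion.\<close>
  have P0: "P q0"
  proof -
    have "filterlim (\<lambda>w. T + w) (nhds (T + - T)) (nhds (- T))" by (intro tendsto_intros filterlim_ident)
    then have "filterlim (\<lambda>w. T + w) (nhds 0) (nhds (- T))" by simp
    from eventually_compose_filterlim[OF bc_series_near_0[OF c t r, folded S_def, OF rS[unfolded S_def]] this]
    have "eventually (\<lambda>w. g w = 0) (nhds (- T))"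
    proof eventually_elim
      case (elim w)
      have "t - (T + w) = T - w" by (simp add: z12(3))
      then show ?case using elim by (simp add: g_def f_def \<theta> S_def flip: A)
    qed
    then show ?thesis using PI[of "- T"] T by (simp add: q0_def strip_def)
  qed
  \<comment> \<open>Along this segment XY is \<tau> times its final value, hence strictly inside the
    disc of convergence for \<tau> < 1.\<close>
  define \<sigma> where "\<sigma> \<tau> = q0 + of_real \<tau> * (q1 - q0)" for \<tau> :: real
  have A\<sigma>: "A (\<sigma> \<tau>) = of_real \<tau> * x0" for \<tau>
  proof -
    have "A (\<sigma> \<tau>) = A q0 + of_real \<tau> * (A q1 - A q0)" by (simp add: A_def \<sigma>_def algebra_simps)
    then show ?thesis by (simp add: A0 A1)
  qed
  have lift: "\<exists>w\<in>strip pi. cosh w = \<sigma> \<tau>" if "0 \<le> \<tau>" "\<tau> \<le> 1" for \<tau>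
    using cosh_strip_surj[of "\<sigma> \<tau>"] cosh_segment_avoids_cut[OF im that]
    unfolding \<sigma>_def q0_def q1_def by metis
  have seg: "P (\<sigma> \<tau>)" if \<tau>: "0 \<le> \<tau>" "\<tau> < 1" for \<tau>
  proof (rule connected_induction_simple[where P = P and S = "\<sigma> ` {0..<1}" and a = q0])
    show "connected (\<sigma> ` {0..<1})"
      by (intro connected_continuous_image) (auto simp: \<sigma>_def intro!: continuous_intros)
    show "q0 \<in> \<sigma> ` {0..<1}" by (rule image_eqI[of _ _ 0]) (auto simp: \<sigma>_def)
    show "\<sigma> \<tau> \<in> \<sigma> ` {0..<1}" using \<tau> by auto
    show "P q0" by (rule P0)
    fix q assume q: "q \<in> \<sigma> ` {0..<1}"
    then obtain \<upsilon> where \<upsilon>: "0 \<le> \<upsilon>" "\<upsilon> < 1" "q = \<sigma> \<upsilon>" by auto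
    then obtain w where w: "w \<in> strip pi" "cosh w = q" using lift[of \<upsilon>] by auto
    have "norm (A q) < r" using \<upsilon> r unfolding \<upsilon>(3) A\<sigma> by (simp add: norm_mult r_def)
    then have "w \<in> V" using w by (simp add: V_def)
    then obtain e where e: "e > 0" "ball w e \<subseteq> V" using V by (meson open_contains_ball)
    have "P y" if xy: "x \<in> cosh ` ball w e" "y \<in> cosh ` ball w e" "P x" for x y
    proof -
      obtain u v where u: "u \<in> ball w e" "x = cosh u" and v: "v \<in> ball w e" "y = cosh v" using xy by auto
      have strips: "u \<in> strip pi" "v \<in> strip pi" using u v e by (auto simp: V_def)
      then have "eventually (\<lambda>w. g w = 0) (nhds u)" using \<open>P x\<close> u by (simp add: P_def)
      then obtain N where N: "open N" "u \<in> N" "\<And>w. w \<in> N \<Longrightarrow> g w = 0" by (auto simp: eventually_nhds)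
      have "g w' = 0" if "w' \<in> ball w e" for w'
        by (rule analytic_continuation_open[of "N \<inter> ball w e" "ball w e" g "\<lambda>_. 0"])
          (use N u e that in \<open>auto intro: holomorphic_on_subset[OF g_hol]\<close>)
      then have "eventually (\<lambda>w. g w = 0) (nhds v)"
        using eventually_nhds_in_open[OF open_ball v(1)] by (auto elim!: eventually_mono)
      then show ?thesis using PI[OF strips(2)] v by simp
    qed
    moreover have "openin (top_of_set (\<sigma> ` {0..<1})) (\<sigma> ` {0..<1} \<inter> cosh ` ball w e)"
      by (intro openin_open_Int open_cosh_image open_ball)
    moreover have "q \<in> \<sigma> ` {0..<1} \<inter> cosh ` ball w e" using q w e by auto
    ultimately show "\<exists>T. openin (top_of_set (\<sigma> ` {0..<1})) T \<and> q \<in> T \<and> (\<forall>x\<in>T. \<forall>y\<in>T. P x \<longrightarrow> P y)"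
      by blast
  qed
  have "((\<lambda>\<tau>. \<theta> (of_real \<tau> * x0)) \<longlongrightarrow> (\<Sum>k. S k * x0 ^ k)) (at_left 1)"
    using Abel_limit[OF sm'] by (simp add: \<theta> power_mult_distrib mult_ac)
  \<comment> \<open>By openness of cosh, values near the endpoint have lifts w with f w close to f
    \<zeta>. It does not matter which lift is met, as \<open>g\<close> vanishes at every lift in the
    strip.\<close>
  moreover have "((\<lambda>\<tau>. \<theta> (of_real \<tau> * x0)) \<longlongrightarrow> f \<zeta>) (at_left 1)"
  proof (rule tendstoI)
    fix e :: real assume e: "e > 0"
    define N where "N = strip pi \<inter> f -` ball (f \<zeta>) e"
    have N: "open N" unfolding N_def
      by (intro continuous_open_preimage holomorphic_on_imp_continuous_on f_hol open_strip open_ball)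
    have "\<zeta> \<in> N" using \<zeta> e by (simp add: N_def)
    then have "\<sigma> 1 \<in> cosh ` N" by (auto simp: \<sigma>_def q1_def)
    have "(\<sigma> \<longlongrightarrow> \<sigma> 1) (at_left 1)" unfolding \<sigma>_def by (intro tendsto_intros)
    then have "eventually (\<lambda>\<tau>. \<sigma> \<tau> \<in> cosh ` N) (at_left 1)"
      by (rule topological_tendstoD[OF _ open_cosh_image[OF N] \<open>\<sigma> 1 \<in> cosh ` N\<close>])
    moreover have "eventually (\<lambda>t. t \<in> {0<..<1}) (at_left (1::real))"
      by (rule eventually_at_leftI[of 0]) auto
    ultimately show "eventually (\<lambda>\<tau>. dist (\<theta> (of_real \<tau> * x0)) (f \<zeta>) < e) (at_left 1)"
    proof eventually_elim
      case (elim \<tau>)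
      then obtain w where w: "w \<in> N" "cosh w = \<sigma> \<tau>" by auto
      then have "eventually (\<lambda>w. g w = 0) (nhds w)"
        using seg[of \<tau>] elim by (auto simp: P_def N_def)
      then have "g w = 0" by (rule eventually_nhds_x_imp_x)
      then have "\<theta> (of_real \<tau> * x0) = f w" using w by (simp add: g_def A\<sigma>)
      then show ?case using w by (simp add: N_def dist_commute)
    qed
  qed
  ultimately have "(\<Sum>k. S k * x0 ^ k) = f \<zeta>" by (rule tendsto_unique[OF trivial_limit_at_left_real])
  then show ?thesis by (simp add: S_def t_def x0_def f_def z12)
qed

subsection \<open>Jacobi functions of the second kind\<close>

lemma cut_complement_iff: "X \<in> - complex_of_real ` {1..} \<longleftrightarrow> 1 - X \<notin> \<real>\<^sub>\<le>\<^sub>0"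
proof -
  have "X \<in> complex_of_real ` {1..} \<longleftrightarrow> 1 - X \<in> \<real>\<^sub>\<le>\<^sub>0"
  proof
    assume "1 - X \<in> \<real>\<^sub>\<le>\<^sub>0"
    then have "X = complex_of_real (Re X)" "Re X \<ge> 1"
      by (auto simp: complex_nonpos_Reals_iff complex_eq_iff)
    then show "X \<in> complex_of_real ` {1..}" by (metis atLeast_iff imageI)
  qed (auto simp: complex_nonpos_Reals_iff)
  then show ?thesis by simp
qed

lemma open_cut_complement: "open (- complex_of_real ` {1..})"
proof -
  have "- complex_of_real ` {1..} = (\<lambda>X. 1 - X) -` (- \<real>\<^sub>\<le>\<^sub>0)"
    using cut_complement_iff by auto
  moreover have "open ((\<lambda>X::complex. 1 - X) -` (- \<real>\<^sub>\<le>\<^sub>0))"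
    by (intro open_vimage continuous_intros) (simp add: open_Compl)
  ultimately show ?thesis by simp
qed

lemma connected_cut_complement: "connected (- complex_of_real ` {1..})"
proof (rule starlike_imp_connected)
  have "closed_segment 0 X \<subseteq> - complex_of_real ` {1..}" if X: "X \<in> - complex_of_real ` {1..}" for X
  proof
    fix w assume "w \<in> closed_segment 0 X"
    then obtain u where u: "0 \<le> u" "u \<le> 1" "w = of_real u * X"
      by (auto simp: closed_segment_def scaleR_conv_of_real)
    show "w \<in> - complex_of_real ` {1..}"
    proof
      assume "w \<in> complex_of_real ` {1..}"
      then obtain r where r: "r \<ge> 1" "w = of_real r" by auto
      then have "u > 0" using u by (cases "u = 0") auto
      then have "X = complex_of_real (r / u)" "r / u \<ge> 1" using u r by (auto simp: field_simps)
      then show False using X by (metis ComplD atLeast_iff imageI)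
    qed
  qed
  moreover have "0 \<in> - complex_of_real ` {1..}" by auto
  ultimately show "starlike (- complex_of_real ` {1..})" unfolding starlike_def by blast
qed

lemma Ln_in_strip:
  assumes "z \<notin> \<real>\<^sub>\<le>\<^sub>0"
  shows "Ln z \<in> strip pi"
proof -
  have "z \<noteq> 0" using assms by auto
  then have "- pi < Im (Ln z)" "Im (Ln z) \<le> pi" by (simp_all add: mpi_less_Im_Ln Im_Ln_le_pi)
  moreover have "Im (Ln z) \<noteq> pi"
    using assms \<open>z \<noteq> 0\<close> by (auto simp: Im_Ln_eq_pi complex_nonpos_Reals_iff)
  ultimately show ?thesis by (simp add: strip_def)
qed

lemma strip_mono: "r \<le> s \<Longrightarrow> strip r \<subseteq> strip s"
  by (auto simp: strip_def)

lemma hyp2F1_reg_series_eq: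
  assumes "c \<notin> \<int>\<^sub>\<le>\<^sub>0" "norm z < 1"
  shows "hyp2F1_reg_series a b c z = rGamma c * eval_fps (hyp_fps a b c) z"
proof -
  have "summable (\<lambda>n. fps_nth (hyp_fps a b c) n * z ^ n)"
    using hyp_fps_conv_radius[OF assms(1), of a b] assms(2) less_le_trans[of "ereal (norm z)" 1]
    by (intro summable_fps) auto
  moreover have "pochhammer a n * pochhammer b n * rGamma (c + of_nat n) * z ^ n / fact n
    = rGamma c * (fps_nth (hyp_fps a b c) n * z ^ n)" for n
    using pochhammer_rGamma[of c n] pochhammer_not_nonpos_Ints_neq[OF assms(1), of n]
    by (simp add: hyp_fps_def)
  ultimately show ?thesis
    by (simp add: hyp2F1_reg_series_def eval_fps_def suminf_mult)
qed

text \<open>On the cut plane Ln(1 - X) lies in the inner strip, so the lift composed with it is a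
  holomorphic continuation of the series.\<close>

lemma hyp2F1_reg_eq_lift:
  assumes c: "c \<notin> \<int>\<^sub>\<le>\<^sub>0" and X: "X \<in> - complex_of_real ` {1..}"
  shows "hyp2F1_reg a b c X = rGamma c * hyp_lift a b c (Ln (1 - X))"
proof -
  let ?S = "- complex_of_real ` {1..}"
  define G where "G X = rGamma c * hyp_lift a b c (Ln (1 - X))" for X
  have ballS: "ball 0 1 \<subseteq> ?S" by auto
  have hl: "(\<lambda>X. hyp_lift a b c (Ln (1 - X))) holomorphic_on ?S"
  proof -
    have "(hyp_lift a b c \<circ> (\<lambda>X. Ln (1 - X))) holomorphic_on ?S"
    proof (rule holomorphic_on_compose_gen[OF _ hyp_lift_holomorphic[OF c]])
      show "(\<lambda>X. Ln (1 - X)) holomorphic_on ?S"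
        by (intro holomorphic_intros) (use cut_complement_iff in blast)+
      show "(\<lambda>X. Ln (1 - X)) ` ?S \<subseteq> strip (2 * pi)"
      proof (rule image_subsetI)
        fix X assume "X \<in> ?S"
        then have "Ln (1 - X) \<in> strip pi" using Ln_in_strip cut_complement_iff by blast
        then show "Ln (1 - X) \<in> strip (2 * pi)" using strip_mono[of pi "2 * pi"] by auto
      qed
    qed
    then show ?thesis by (simp add: o_def)
  qed
  then have G: "G holomorphic_on ?S" unfolding G_def by (intro holomorphic_intros)
  have "hyp_lift a b c (Ln (1 - z)) - eval_fps (hyp_fps a b c) z = 0" if z: "z \<in> ball 0 1" for z
  proof (rule has_fps_expansion_0_analytic_continuation[where A = "ball 0 1"
      and f = "\<lambda>X. hyp_lift a b c (Ln (1 - X)) - eval_fps (hyp_fps a b c) X" and x = z])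
    have "isCont (\<lambda>X::complex. Ln (1 - X)) 0" by (intro continuous_intros) auto
    then have "filterlim (\<lambda>X::complex. Ln (1 - X)) (nhds 0) (nhds 0)"
      using tendsto_at_iff_tendsto_nhds[of "\<lambda>X::complex. Ln (1 - X)" 0] by (simp add: isCont_def)
    from eventually_compose_filterlim[OF hyp_lift_near_0[OF c, of a b] this]
    have "eventually (\<lambda>X. hyp_lift a b c (Ln (1 - X)) = eval_fps (hyp_fps a b c) (1 - exp (Ln (1 - X)))) (nhds 0)" .
    moreover have "eventually (\<lambda>X. X \<in> ball 0 1) (nhds (0::complex))"
      by (intro eventually_nhds_in_open) auto
    ultimately have "eventually (\<lambda>X. hyp_lift a b c (Ln (1 - X)) - eval_fps (hyp_fps a b c) X = 0) (nhds 0)"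
    proof eventually_elim
      case (elim X)
      then have "1 - X \<noteq> 0" by auto
      then have "exp (Ln (1 - X)) = 1 - X" by simp
      then show ?case using elim(1) by simp
    qed
    then show "(\<lambda>X. hyp_lift a b c (Ln (1 - X)) - eval_fps (hyp_fps a b c) X) has_fps_expansion 0"
      by (simp add: has_fps_expansion_0_iff)
    show "(\<lambda>X. hyp_lift a b c (Ln (1 - X)) - eval_fps (hyp_fps a b c) X) holomorphic_on ball 0 1"
      using hyp_fps_conv_radius[OF c, of a b] less_le_trans[of "ereal _" 1 "fps_conv_radius (hyp_fps a b c)"]
      by (intro holomorphic_on_diff holomorphic_on_subset[OF hl ballS] holomorphic_on_eval_fps)
        (auto simp: subset_eq in_eball_iff)
  qed (use z in auto)
  then have Gb: "G z = hyp2F1_reg_series a b c z" if "z \<in> ball 0 1" for z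
    using that hyp2F1_reg_series_eq[OF c, of z a b] by (simp add: G_def)
  define F where "F = hyp2F1_reg a b c"
  \<comment> \<open>\<open>G\<close> witnesses that the defining choice is not vacuous; the identity
    theorem then shows that the chosen function is \<open>G\<close>.\<close>
  have "F holomorphic_on ?S \<and> (\<forall>z\<in>ball 0 1. F z = hyp2F1_reg_series a b c z)"
    unfolding F_def hyp2F1_reg_def by (rule someI[of _ G]) (use G Gb in auto)
  then have "F X = G X"
    by (intro analytic_continuation_open[of "ball 0 1" ?S F G X])
      (use open_cut_complement connected_cut_complement ballS G Gb X in auto)
  then show ?thesis by (simp add: F_def G_def)
qed

section \<open>The logarithmic coordinate and the elementary factor of Q\<close>

lemma cut_planeD:
  assumes "x \<in> cut_plane"
  shows "x - 1 \<notin> \<real>\<^sub>\<le>\<^sub>0" "x + 1 \<notin> \<real>\<^sub>\<le>\<^sub>0" "(x + 1) / (x - 1) \<notin> \<real>\<^sub>\<le>\<^sub>0" "x - 1 \<noteq> 0" "x + 1 \<noteq> 0"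
proof -
  have nr: "x \<noteq> complex_of_real r" if "r \<le> 1" for r
    using assms that by (auto simp: cut_plane_def)
  show 1: "x - 1 \<notin> \<real>\<^sub>\<le>\<^sub>0"
  proof
    assume "x - 1 \<in> \<real>\<^sub>\<le>\<^sub>0"
    then obtain r where "r \<le> 0" "x - 1 = of_real r" by (auto elim!: nonpos_Reals_cases)
    then show False using nr[of "r + 1"] by (simp add: algebra_simps)
  qed
  show 2: "x + 1 \<notin> \<real>\<^sub>\<le>\<^sub>0"
  proof
    assume "x + 1 \<in> \<real>\<^sub>\<le>\<^sub>0"
    then obtain r where "r \<le> 0" "x + 1 = of_real r" by (auto elim!: nonpos_Reals_cases)
    then show False using nr[of "r - 1"] by (simp add: algebra_simps)
  qed
  show nz: "x - 1 \<noteq> 0" "x + 1 \<noteq> 0" using 1 2 by auto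
  show "(x + 1) / (x - 1) \<notin> \<real>\<^sub>\<le>\<^sub>0"
  proof
    assume "(x + 1) / (x - 1) \<in> \<real>\<^sub>\<le>\<^sub>0"
    then obtain r where r: "r \<le> 0" "(x + 1) / (x - 1) = of_real r" by (auto elim!: nonpos_Reals_cases)
    then have "x * of_real (1 - r) = of_real (- 1 - r)"
      using nz by (simp add: field_simps)
    then have "x = of_real ((- 1 - r) / (1 - r))"
      using r(1) by (simp add: field_simps flip: of_real_diff)
    moreover have "(- 1 - r) / (1 - r) \<le> 1" using r(1) by (simp add: field_simps)
    ultimately show False using nr by blast
  qed
qed

lemma open_cut_plane: "open cut_plane"
proof -
  have "cut_plane = (\<lambda>x. 2 - x) -` (- complex_of_real ` {1..})"
  proof -
    have "x \<in> complex_of_real ` {..1} \<longleftrightarrow> 2 - x \<in> complex_of_real ` {1..}" for x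
    proof
      assume "2 - x \<in> complex_of_real ` {1..}"
      then obtain r where "r \<ge> 1" "2 - x = of_real r" by auto
      then have "x = of_real (2 - r)" "2 - r \<le> 1" by (simp_all add: algebra_simps)
      then show "x \<in> complex_of_real ` {..1}" by blast
    next
      assume "x \<in> complex_of_real ` {..1}"
      then obtain r where "r \<le> 1" "x = of_real r" by auto
      then have "2 - x = of_real (2 - r)" "2 - r \<ge> 1" by simp_all
      then show "2 - x \<in> complex_of_real ` {1..}" by blast
    qed
    then show ?thesis unfolding cut_plane_def by auto
  qed
  then show ?thesis using open_vimage[OF open_cut_complement, of "\<lambda>x. 2 - x"]
    by (simp add: continuous_intros)
qed

text \<open>The variable z = ln(1 - X) for X = 2/(1 - x), since then 1 - X = (x + 1)/(x -
  1).\<close>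

definition log_xi :: "complex \<Rightarrow> complex" where
  "log_xi x = Ln ((x + 1) / (x - 1))"

definition jacobi_weight :: "complex \<Rightarrow> complex \<Rightarrow> complex \<Rightarrow> complex" where
  "jacobi_weight p B x = 1 / ((x - 1) powr p * (x + 1) powr B)"

lemma log_xi_in_strip: "x \<in> cut_plane \<Longrightarrow> log_xi x \<in> strip pi"
  unfolding log_xi_def by (intro Ln_in_strip cut_planeD)

lemma exp_log_xi:
  assumes "x \<in> cut_plane"
  shows "1 - exp (log_xi x) = - 2 / (x - 1)"
  using cut_planeD[OF assms] by (simp add: log_xi_def field_simps)

lemma jacobi_Q_eq_lift:
  assumes x: "x \<in> cut_plane" and s: "A + B + 2 * C + 2 \<notin> \<int>\<^sub>\<le>\<^sub>0"
  shows "jacobi_Q A B C x = 2 powr (A + B + C) * Gamma (A + C + 1) * Gamma (B + C + 1) * jacobi_weight (A + C + 1) B x *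
    (rGamma (A + B + 2 * C + 2) * hyp_lift (C + 1) (A + C + 1) (A + B + 2 * C + 2) (log_xi x))"
proof -
  note nz = cut_planeD[OF x]
  have "1 - x \<noteq> 0" using nz by auto
  then have eq: "1 - 2 / (1 - x) = (x + 1) / (x - 1)" using nz by (simp add: field_simps)
  then have "2 / (1 - x) \<in> - complex_of_real ` {1..}" using nz unfolding cut_complement_iff by simp
  from hyp2F1_reg_eq_lift[OF s this, of "C + 1" "A + C + 1"] show ?thesis
    by (simp add: jacobi_Q_def jacobi_weight_def log_xi_def eq)
qed

section \<open>Single-valued form of the summands\<close>

lemma bc_lift_holomorphic_left:
  assumes s: "s \<notin> \<int>\<^sub>\<le>\<^sub>0" and v: "v \<in> cut_plane"
  shows "(\<lambda>u. bc_lift a b s k (log_xi u + log_xi v)) holomorphic_on cut_plane"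
proof -
  have "(bc_lift a b s k \<circ> (\<lambda>u. log_xi u + log_xi v)) holomorphic_on cut_plane"
  proof (rule holomorphic_on_compose_gen[OF _ bc_lift_holomorphic[OF s]])
    show "(\<lambda>u. log_xi u + log_xi v) holomorphic_on cut_plane"
      unfolding log_xi_def by (intro holomorphic_intros) (use cut_planeD in auto)
    show "(\<lambda>u. log_xi u + log_xi v) ` cut_plane \<subseteq> strip (2 * pi)"
      using log_xi_in_strip[OF v] log_xi_in_strip by (fastforce simp: strip_def)
  qed
  then show ?thesis by (simp add: o_def)
qed

text \<open>The common continuation of the prefactor times the k-th function on the right. All
  non-integer powers have base u - 1, u + 1, v - 1 or v + 1, harmless on the cut plane; u + v
  survives only to the integer power k, so nothing branches at u + v = 0.\<close>

definition bc_summand :: "complex \<Rightarrow> complex \<Rightarrow> complex \<Rightarrow> nat \<Rightarrow> complex \<times> complex \<Rightarrow> complex" where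
  "bc_summand A B C k = (\<lambda>(u, v). 2 powr (A + B + C + 1) * 2 powr (A + B + C + of_nat k) *
     Gamma (A + C + 1 + of_nat k) * Gamma (B + C + 1 + of_nat k) * rGamma (A + B + 2 * C + 2 + 2 * of_nat k) *
     (jacobi_weight (A + C + 1) B u * jacobi_weight (A + C + 1) B v * (u + v) ^ k / ((u - 1) * (v - 1)) ^ k) *
     bc_lift (C + 1) (A + C + 1) (A + B + 2 * C + 2) k (log_xi u + log_xi v))"

lemma bc_summand_commute: "bc_summand A B C k (u, v) = bc_summand A B C k (v, u)"
  by (simp add: bc_summand_def mult_ac add_ac)

lemma bc_summand_holomorphic_left:
  assumes s: "A + B + 2 * C + 2 \<notin> \<int>\<^sub>\<le>\<^sub>0" and v: "v \<in> cut_plane"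
  shows "(\<lambda>u. bc_summand A B C k (u, v)) holomorphic_on cut_plane"
  unfolding bc_summand_def jacobi_weight_def prod.case
  by (intro holomorphic_intros bc_lift_holomorphic_left[OF s v]) (use cut_planeD v in auto)

lemma bc_summand_separately_holomorphic:
  assumes "A + B + 2 * C + 2 \<notin> \<int>\<^sub>\<le>\<^sub>0" "U \<subseteq> cut_plane \<times> cut_plane"
  shows "separately_holomorphic_on (bc_summand A B C k) U"
proof -
  have "(\<lambda>z. bc_summand A B C k (z, v)) field_differentiable at u"
    if "u \<in> cut_plane" "v \<in> cut_plane" for u v
    using bc_summand_holomorphic_left[OF assms(1) that(2)] open_cut_plane that(1)
    by (rule holomorphic_on_imp_differentiable_at)
  then show ?thesis
    using assms(2) unfolding separately_holomorphic_on_def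
    by (auto simp: bc_summand_commute[of A B C k _ "_ :: complex"] subset_eq)
qed

lemma holomorphic2_imp_separately:
  assumes "holomorphic2_on f U"
  shows "separately_holomorphic_on f U"
  unfolding separately_holomorphic_on_def
proof (clarify, intro conjI)
  fix u v assume "(u, v) \<in> U"
  then obtain a b where d: "(f has_derivative (\<lambda>(h, k). a * h + b * k)) (at (u, v))"
    using assms unfolding holomorphic2_on_def by blast
  have "((\<lambda>z. f (z, v)) has_derivative (\<lambda>h. (\<lambda>(h, k). a * h + b * k) (h, 0))) (at u)"
    by (rule has_derivative_compose[of "\<lambda>z. (z, v)", OF _ d]) (auto intro!: derivative_eq_intros)
  then show "(\<lambda>z. f (z, v)) field_differentiable at u"
    by (auto simp: field_differentiable_def has_field_derivative_def)
  have "((\<lambda>w. f (u, w)) has_derivative (\<lambda>h. (\<lambda>(h, k). a * h + b * k) (0, h))) (at v)"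
    by (rule has_derivative_compose[of "\<lambda>w. (u, w)", OF _ d]) (auto intro!: derivative_eq_intros)
  then show "(\<lambda>w. f (u, w)) field_differentiable at v"
    by (auto simp: field_differentiable_def has_field_derivative_def)
qed

text \<open>For real u, v > 1 all bases are positive, so the factorizations of z - 1 and z + 1 turn
  into sums of real logarithms: powers split and \<open>log_xi\<close> becomes additive.\<close>

lemma bc_summand_basic_range:
  fixes u v :: real
  assumes uv: "u > 1" "v > 1" and s: "A + B + 2 * C + 2 \<notin> \<int>\<^sub>\<le>\<^sub>0"
  shows "(2 / (of_real u + of_real v)) powr (A + B + C + 1) *
      jacobi_Q A B (C + of_nat k) ((1 + of_real u * of_real v) / (of_real u + of_real v))
    = bc_summand A B C k (of_real u, of_real v)"
proof -
  define z where "z = (1 + u * v) / (u + v)"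
  have uv0: "u + v > 0" using uv by simp
  have z1: "z - 1 = (u - 1) * (v - 1) / (u + v)" and z2: "z + 1 = (u + 1) * (v + 1) / (u + v)"
    using uv0 by (simp_all add: z_def field_simps)
  have "z - 1 > 0" unfolding z1 using uv uv0 by (intro divide_pos_pos mult_pos_pos) auto
  then have zgt: "z > 1" by simp
  have zc: "complex_of_real z \<in> cut_plane" using zgt by (auto simp: cut_plane_def)
  have zz: "(1 + of_real u * of_real v) / (of_real u + of_real v) = complex_of_real z"
    by (simp add: z_def)
  have lz1: "ln (z - 1) = ln (u - 1) + ln (v - 1) - ln (u + v)"
    unfolding z1 using uv by (simp add: ln_div ln_mult)
  have lz2: "ln (z + 1) = ln (u + 1) + ln (v + 1) - ln (u + v)"
    unfolding z2 using uv by (simp add: ln_div ln_mult)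
  have pw: "complex_of_real r powr w = exp (w * of_real (ln r))" if "r > 0" for r w
    using that by (simp add: powr_def Ln_of_real)
  have lx: "log_xi (of_real r) = of_real (ln (r + 1) - ln (r - 1))" if "r > 1" for r
  proof -
    have pos: "(r + 1) / (r - 1) > 0" using that by simp
    have "log_xi (of_real r) = Ln (of_real ((r + 1) / (r - 1)))" by (simp add: log_xi_def)
    also have "\<dots> = of_real (ln ((r + 1) / (r - 1)))" by (rule Ln_of_real[OF pos])
    also have "ln ((r + 1) / (r - 1)) = ln (r + 1) - ln (r - 1)" using that by (simp add: ln_div)
    finally show ?thesis .
  qed
  have lxz: "log_xi (of_real z) = log_xi (of_real u) + log_xi (of_real v)"
    using uv zgt by (simp add: lx lz1 lz2)
  have s': "A + B + 2 * (C + of_nat k) + 2 \<notin> \<int>\<^sub>\<le>\<^sub>0"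
    using two_k_not_nonpos_Ints[OF s, of k] by (simp add: algebra_simps)
  have jw: "jacobi_weight w B (of_real r) = exp (- w * of_real (ln (r - 1)) - B * of_real (ln (r + 1)))" if "r > 1" for r w
  proof -
    have "complex_of_real r - 1 = of_real (r - 1)" "complex_of_real r + 1 = of_real (r + 1)" by simp_all
    then have "jacobi_weight w B (of_real r) = 1 / (exp (w * of_real (ln (r - 1))) * exp (B * of_real (ln (r + 1))))"
      using that unfolding jacobi_weight_def by (simp only: pw)
    then show ?thesis by (simp add: exp_diff exp_minus divide_simps)
  qed
  have two: "(2 / (complex_of_real u + of_real v)) powr w = exp (w * of_real (ln 2 - ln (u + v)))" for w :: complex
  proof -
    have "2 / (complex_of_real u + of_real v) = of_real (2 / (u + v))" by simp
    then have "(2 / (complex_of_real u + of_real v)) powr w = exp (w * of_real (ln (2 / (u + v))))"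
      using pw[of "2 / (u + v)" w] uv0 by (simp only: divide_pos_pos zero_less_numeral)
    then show ?thesis using uv0 by (simp add: ln_div)
  qed
  have two': "2 powr w = exp (w * of_real (ln 2))" for w :: complex using pw[of 2 w] by simp
  have jwz: "jacobi_weight (A + (C + of_nat k) + 1) B (of_real z)
    = jacobi_weight (A + C + 1) B (of_real z) * ((u + v) ^ k / ((u - 1) * (v - 1)) ^ k)"
  proof -
    have "jacobi_weight (A + (C + of_nat k) + 1) B (of_real z)
       = jacobi_weight (A + C + 1) B (of_real z) * exp (of_nat k * of_real (- ln (z - 1)))"
      using zgt by (simp add: jw algebra_simps flip: exp_add)
    also have "exp (of_nat k * complex_of_real (- ln (z - 1))) = exp (complex_of_real (- ln (z - 1))) ^ k"
      by (rule exp_of_nat_mult)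
    also have "\<dots> = of_real (exp (- ln (z - 1)) ^ k)" by (simp only: exp_of_real of_real_power)
    also have "exp (- ln (z - 1)) = (u + v) / ((u - 1) * (v - 1))"
      using zgt uv by (simp add: exp_minus z1)
    finally show ?thesis by (simp add: power_divide)
  qed
  \<comment> \<open>The weight at z contributes u + v to the power A + B + C + 1, cancelling exactly
    the one in the prefactor.\<close>
  have key: "(2 / (of_real u + of_real v)) powr (A + B + C + 1) * jacobi_weight (A + C + 1) B (of_real z)
    = 2 powr (A + B + C + 1) * (jacobi_weight (A + C + 1) B (of_real u) * jacobi_weight (A + C + 1) B (of_real v))"
    unfolding two two' jw[OF uv(1)] jw[OF uv(2)] jw[OF zgt] lz1 lz2
    by (simp add: algebra_simps flip: exp_add)
  have "(2 / (of_real u + of_real v)) powr (A + B + C + 1) * jacobi_Q A B (C + of_nat k) (of_real z)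
    = ((2 / (of_real u + of_real v)) powr (A + B + C + 1) * jacobi_weight (A + C + 1) B (of_real z)) *
      (2 powr (A + B + C + of_nat k) *
     Gamma (A + C + 1 + of_nat k) * Gamma (B + C + 1 + of_nat k) * rGamma (A + B + 2 * C + 2 + 2 * of_nat k) *
     ((u + v) ^ k / ((u - 1) * (v - 1)) ^ k) *
     bc_lift (C + 1) (A + C + 1) (A + B + 2 * C + 2) k (log_xi u + log_xi v))"
    unfolding jacobi_Q_eq_lift[OF zc s'] jwz lxz bc_lift_def
    by (simp add: mult_ac add_ac distrib_left)
  also have "\<dots> = bc_summand A B C k (of_real u, of_real v)"
    unfolding key by (simp add: bc_summand_def mult_ac)
  finally show ?thesis unfolding zz .
qed

lemma islimpt_real_ray:
  assumes "(a::real) < t"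
  shows "complex_of_real t islimpt complex_of_real ` {a<..}"
  unfolding islimpt_approachable
proof (intro allI impI)
  fix e :: real assume e: "e > 0"
  have "complex_of_real (t + e / 2) \<in> complex_of_real ` {a<..}"
    by (rule imageI) (use assms e in simp)
  moreover have "complex_of_real (t + e / 2) \<noteq> complex_of_real t"
    "dist (complex_of_real (t + e / 2)) (complex_of_real t) < e"
    using e by (simp_all only: dist_of_real of_real_eq_iff) (simp_all add: dist_real_def)
  ultimately show "\<exists>x'\<in>complex_of_real ` {a<..}. x' \<noteq> complex_of_real t \<and> dist x' (complex_of_real t) < e"
    by blast
qed

text \<open>\<open>P\<close> and \<open>W\<close> separately may depend on how \<open>U\<close>
  winds around u + v = 0. Their product does not: on the basic range it equals a function
  holomorphic on the whole product of cut planes.\<close>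

lemma continuation_product_eq_bc_summand:
  assumes s: "A + B + 2 * C + 2 \<notin> \<int>\<^sub>\<le>\<^sub>0" and xy: "(x, y) \<in> U"
    and P: "continuation_on U (\<lambda>u v. (2 / (u + v)) powr (A + B + C + 1)) P"
    and W: "continuation_on U (\<lambda>u v. jacobi_Q A B (C + of_nat k) ((1 + u * v) / (u + v))) W"
  shows "P (x, y) * W (x, y) = bc_summand A B C k (x, y)"
proof -
  have U: "open U" "connected U" "basic_range \<subseteq> U" "U \<subseteq> cut_plane \<times> cut_plane"
    using P by (auto simp: continuation_on_def var_domain_def)
  have sep: "separately_holomorphic_on P U" "separately_holomorphic_on W U"
    using P W by (auto simp: continuation_on_def intro: holomorphic2_imp_separately)
  have "separately_holomorphic_on (\<lambda>p. P p * W p - bc_summand A B C k p) U"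
    using sep bc_summand_separately_holomorphic[OF s U(4), of k] unfolding separately_holomorphic_on_def
    by (auto intro!: field_differentiable_diff field_differentiable_mult)
  then have "P (x, y) * W (x, y) - bc_summand A B C k (x, y) = 0"
  proof (rule separately_holomorphic_identity[OF _ U(1,2)])
    show "complex_of_real ` {1<..} \<times> complex_of_real ` {1<..} \<subseteq> U"
      using U(3) by (simp add: basic_range_def)
    show "complex_of_real 2 \<in> complex_of_real ` {1<..}" "complex_of_real 2 \<in> complex_of_real ` {1<..}"
      by (rule imageI; simp)+
    show "complex_of_real 2 islimpt complex_of_real ` {1<..}" "complex_of_real 2 islimpt complex_of_real ` {1<..}"
      by (rule islimpt_real_ray; simp)+
    fix u v assume "u \<in> complex_of_real ` {1<..}" "v \<in> complex_of_real ` {1<..}"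
    then obtain u' v' where uv: "u = of_real u'" "v = of_real v'" "u' > 1" "v' > 1" by auto
    then have "(u, v) \<in> basic_range" by (auto simp: basic_range_def)
    then have "P (u, v) = (2 / (u + v)) powr (A + B + C + 1)"
      "W (u, v) = jacobi_Q A B (C + of_nat k) ((1 + u * v) / (u + v))"
      using P W by (auto simp: continuation_on_def)
    then show "P (u, v) * W (u, v) - bc_summand A B C k (u, v) = 0"
      using bc_summand_basic_range[OF uv(3,4) s, of k] by (simp add: uv(1,2))
  qed (rule xy)
  then show ?thesis by simp
qed

lemma Gamma_add_of_nat:
  assumes "(z::complex) \<notin> \<int>\<^sub>\<le>\<^sub>0"
  shows "Gamma (z + of_nat n) = pochhammer z n * Gamma z"
  using pochhammer_Gamma[OF assms, of n] assms by (simp add: Gamma_eq_zero_iff)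

text \<open>With a = C + 1, b = A + C + 1 and s' = A + B + 2C + 2, the factors (a)_k (s' - a)_k are
  explicit, while (b)_k, (s' - b)_k and 1/(s')_(2k) come from the Gamma factors of the k-th
  function; together they form \<open>bc_coeff\<close>.\<close>

lemma jacobi_Q_product_formula:
  fixes A B C x y :: complex
  assumes p: "A + C + 1 \<notin> \<int>\<^sub>\<le>\<^sub>0" and q: "B + C + 1 \<notin> \<int>\<^sub>\<le>\<^sub>0" and s: "A + B + 2 * C + 2 \<notin> \<int>\<^sub>\<le>\<^sub>0"
    and xy: "(x, y) \<in> U"
    and P: "continuation_on U (\<lambda>u v. (2 / (u + v)) powr (A + B + C + 1)) P"
    and W: "\<And>k. continuation_on U (\<lambda>u v. jacobi_Q A B (C + of_nat k) ((1 + u * v) / (u + v))) (W k)"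
    and sm: "summable (\<lambda>k. pochhammer (C + 1) k * pochhammer (A + B + C + 1) k /
      (pochhammer (A + B + 2 * C + 2) k * fact k) * (2 / (x + y)) ^ k * W k (x, y))"
  shows "jacobi_Q A B C x * jacobi_Q A B C y =
    Gamma (A + C + 1) * Gamma (B + C + 1) / (2 * Gamma (A + B + 2 * C + 2)) * P (x, y) *
    (\<Sum>k. pochhammer (C + 1) k * pochhammer (A + B + C + 1) k /
      (pochhammer (A + B + 2 * C + 2) k * fact k) * (2 / (x + y)) ^ k * W k (x, y))"
proof -
  define a b s' where "a = C + 1" and "b = A + C + 1" and "s' = A + B + 2 * C + 2"
  have sa: "s' - a = A + B + C + 1" "s' - b = B + C + 1" by (simp_all add: a_def b_def s'_def)
  have x: "x \<in> cut_plane" and y: "y \<in> cut_plane" and xy0: "x + y \<noteq> 0"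
    using xy P by (auto simp: continuation_on_def var_domain_def)
  define K where "K = 2 powr (A + B + C)"
  define w where "w = jacobi_weight b B x * jacobi_weight b B y"
  define c where "c k = pochhammer a k * pochhammer (s' - a) k / (pochhammer s' k * fact k) * (2 / (x + y)) ^ k * W k (x, y)" for k
  \<comment> \<open>The part of P times the k-th term that does not depend on k. One factor
    \<open>2 * K\<close> comes from \<open>P\<close>, the other \<open>K\<close> from the
    normalisation of Q.\<close>
  define M where "M = 2 * K * K * Gamma b * Gamma (s' - b) * rGamma s' * w"
  define T where "T k = bc_coeff a b s' k * bc_lift a b s' k (log_xi x + log_xi y) *
    ((1 - exp (log_xi x)) * (1 - exp (log_xi y))) ^ k" for k
  have K: "2 powr (A + B + C + 1) = 2 * K" "2 powr (A + B + C + of_nat k) = K * 2 ^ k" for k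
    by (simp_all add: K_def powr_add powr_nat')
  have nz: "x - 1 \<noteq> 0" "x + 1 \<noteq> 0" "y - 1 \<noteq> 0" "y + 1 \<noteq> 0"
    using cut_planeD[OF x] cut_planeD[OF y] by auto
  have s0: "s' \<notin> \<int>\<^sub>\<le>\<^sub>0" using s by (simp add: s'_def)
  have PW: "P (x, y) * c k = M * T k" for k
  proof -
    have g: "Gamma (b + of_nat k) = pochhammer b k * Gamma b"
      "Gamma (s' - b + of_nat k) = pochhammer (s' - b) k * Gamma (s' - b)"
      using Gamma_add_of_nat[OF p, of k] Gamma_add_of_nat[OF q, of k] by (simp_all add: b_def sa(2)[unfolded b_def])
    have "rGamma s' = pochhammer s' (2 * k) * rGamma (s' + 2 * of_nat k)"
      using pochhammer_rGamma[of s' "2 * k"] by simp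
    then have rg: "rGamma (s' + 2 * of_nat k) = rGamma s' / pochhammer s' (2 * k)"
      using pochhammer_not_nonpos_Ints_neq[OF s0, of "2 * k"] by (simp add: field_simps)
    \<comment> \<open>Here XY = 4/((x - 1)(y - 1)): one factor 2 per index is explicit in the
      series, the other sits in the power of 2 in Q, and x + y cancels.\<close>
    have pw: "(2 / (x + y)) ^ k * 2 ^ k * ((x + y) ^ k / ((x - 1) * (y - 1)) ^ k)
      = ((1 - exp (log_xi x)) * (1 - exp (log_xi y))) ^ k"
    proof -
      have "(1 - exp (log_xi x)) * (1 - exp (log_xi y)) = 2 / (x + y) * 2 * ((x + y) / ((x - 1) * (y - 1)))"
        unfolding exp_log_xi[OF x] exp_log_xi[OF y] using xy0 nz by (simp add: divide_simps)
      then show ?thesis by (simp only: power_mult_distrib power_divide)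
    qed
    have "P (x, y) * c k = pochhammer a k * pochhammer (s' - a) k / (pochhammer s' k * fact k) * (2 / (x + y)) ^ k *
       (P (x, y) * W k (x, y))"
      by (simp add: c_def)
    also have "P (x, y) * W k (x, y) = bc_summand A B C k (x, y)"
      by (rule continuation_product_eq_bc_summand[OF s xy P W])
    also have "\<dots> = (2 * K) * (K * 2 ^ k) * (pochhammer b k * Gamma b) * (pochhammer (s' - b) k * Gamma (s' - b)) *
      (rGamma s' / pochhammer s' (2 * k)) * (w * ((x + y) ^ k / ((x - 1) * (y - 1)) ^ k)) *
      bc_lift a b s' k (log_xi x + log_xi y)"
      unfolding bc_summand_def prod.case K sa(2)[symmetric]
      unfolding a_def[symmetric] b_def[symmetric] s'_def[symmetric] g rg w_def by (simp add: mult_ac)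
    also have "pochhammer a k * pochhammer (s' - a) k / (pochhammer s' k * fact k) * (2 / (x + y)) ^ k * \<dots>
      = M * (bc_coeff a b s' k * bc_lift a b s' k (log_xi x + log_xi y) *
        ((2 / (x + y)) ^ k * 2 ^ k * ((x + y) ^ k / ((x - 1) * (y - 1)) ^ k)))"
      unfolding M_def bc_coeff_def by (simp add: mult_ac)
    finally show ?thesis unfolding pw T_def .
  qed
  have "w \<noteq> 0" using nz by (simp add: w_def jacobi_weight_def powr_def)
  moreover have "b \<notin> \<int>\<^sub>\<le>\<^sub>0" using p by (simp add: b_def)
  moreover have "s' - b \<notin> \<int>\<^sub>\<le>\<^sub>0" using q by (simp add: sa)
  \<comment> \<open>Nonvanishing of \<open>M\<close> allows the assumed summability to be
    transferred to the expansion itself.\<close>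
  ultimately have M0: "M \<noteq> 0"
    using s0 by (simp add: M_def K_def Gamma_eq_zero_iff rGamma_eq_zero_iff powr_def)
  have smc: "summable c" using sm unfolding c_def[abs_def] sa unfolding a_def s'_def .
  then have "summable (\<lambda>k. M * T k)" using summable_mult[OF smc, of "P (x, y)"] by (simp add: PW)
  then have smT: "summable T" using M0 by (simp add: summable_cmult_iff)
  have T: "(\<Sum>k. T k) = bc_lift a b s' 0 (log_xi x) * bc_lift a b s' 0 (log_xi y)"
    unfolding T_def
  proof (rule bc_sum[OF s0 log_xi_in_strip[OF x] log_xi_in_strip[OF y]])
    show "(1 - exp (log_xi x)) * (1 - exp (log_xi y)) \<noteq> 0"
      using nz by (simp add: exp_log_xi x y)
  qed (use smT in \<open>simp add: T_def[abs_def]\<close>)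
  have "P (x, y) * (\<Sum>k. c k) = (\<Sum>k. M * T k)"
    using suminf_mult[OF smc, of "P (x, y)"] by (simp add: PW)
  also have "\<dots> = M * (\<Sum>k. T k)" by (rule suminf_mult[OF smT])
  finally have "Gamma b * Gamma (s' - b) / (2 * Gamma s') * (P (x, y) * (\<Sum>k. c k))
    = Gamma b * Gamma (s' - b) / (2 * Gamma s') * (M * (bc_lift a b s' 0 (log_xi x) * bc_lift a b s' 0 (log_xi y)))"
    by (simp add: T)
  also have "\<dots> = jacobi_Q A B C x * jacobi_Q A B C y"
    unfolding jacobi_Q_eq_lift[OF x s] jacobi_Q_eq_lift[OF y s] sa(2)[symmetric]
    unfolding a_def[symmetric] b_def[symmetric] s'_def[symmetric] K_def[symmetric] M_def w_def bc_lift_def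
    by (simp add: rGamma_inverse_Gamma field_simps)
  finally show ?thesis
    unfolding c_def[abs_def] sa unfolding a_def b_def s'_def by (simp add: mult.assoc)
qed

theorem theorem44:
  fixes x y lam \<mu> \<alpha> \<beta> \<gamma> :: complex
    and U :: "(complex \<times> complex) set"
    and P :: "complex \<times> complex \<Rightarrow> complex"
    and W :: "nat \<Rightarrow> complex \<times> complex \<Rightarrow> complex"
  assumes "x \<in> cut_plane" and "y \<in> cut_plane" and "x + y \<noteq> 0"
    and "\<And>n::nat. \<alpha> + \<gamma> + lam \<noteq> - of_nat (Suc n)"
    and "\<And>n::nat. \<beta> + \<gamma> - lam \<noteq> - of_nat (Suc n)"
    and "\<And>n::nat. \<alpha> + \<beta> + 2 * \<gamma> + 2 \<noteq> - of_nat n"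
    and "(x, y) \<in> U"
    and "continuation_on U
           (\<lambda>u v. (2 / (u + v)) powr (\<alpha> + \<beta> + \<gamma> + lam + \<mu> + 1)) P"
    and "\<And>k. continuation_on U
           (\<lambda>u v. jacobi_Q (\<alpha> + 2 * lam + \<mu>) (\<beta> + \<mu>) (\<gamma> - lam - \<mu> + of_nat k)
                    ((1 + u * v) / (u + v))) (W k)"
    and "summable (\<lambda>k.
           pochhammer (\<gamma> - lam - \<mu> + 1) k * pochhammer (\<alpha> + \<beta> + \<gamma> + lam + \<mu> + 1) k /
             (pochhammer (\<alpha> + \<beta> + 2 * \<gamma> + 2) k * fact k) *
           (2 / (x + y)) ^ k * W k (x, y))"
  shows "jacobi_Q (\<alpha> + 2 * lam + \<mu>) (\<beta> + \<mu>) (\<gamma> - lam - \<mu>) x *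
         jacobi_Q (\<alpha> + 2 * lam + \<mu>) (\<beta> + \<mu>) (\<gamma> - lam - \<mu>) y =
         Gamma (\<alpha> + \<gamma> + lam + 1) * Gamma (\<beta> + \<gamma> - lam + 1) /
           (2 * Gamma (\<alpha> + \<beta> + 2 * \<gamma> + 2)) * P (x, y) *
         (\<Sum>k. pochhammer (\<gamma> - lam - \<mu> + 1) k *
                pochhammer (\<alpha> + \<beta> + \<gamma> + lam + \<mu> + 1) k /
                  (pochhammer (\<alpha> + \<beta> + 2 * \<gamma> + 2) k * fact k) *
                (2 / (x + y)) ^ k * W k (x, y))"
proof -
  \<comment> \<open>The five parameters enter only through these three combinations: \<lambda> and
    \<mu> merely redistribute the upper and lower indices of Q.\<close>
  define A B C where "A = \<alpha> + 2 * lam + \<mu>" and "B = \<beta> + \<mu>" and "C = \<gamma> - lam - \<mu>"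
  have eqs: "\<alpha> + \<gamma> + lam + 1 = A + C + 1" "\<beta> + \<gamma> - lam + 1 = B + C + 1"
    "\<alpha> + \<beta> + 2 * \<gamma> + 2 = A + B + 2 * C + 2" "\<alpha> + \<beta> + \<gamma> + lam + \<mu> + 1 = A + B + C + 1"
    by (simp_all add: A_def B_def C_def algebra_simps)
  \<comment> \<open>The assumptions exclude -1, -2, ... before the shift by 1, hence
    \<open>Suc n\<close>; afterwards these are exactly the poles of Gamma.\<close>
  have shift: "z + 1 \<notin> \<int>\<^sub>\<le>\<^sub>0" if "\<And>n. z \<noteq> - of_nat (Suc n)" for z :: complex
  proof
    assume "z + 1 \<in> \<int>\<^sub>\<le>\<^sub>0"
    then obtain n where "z + 1 = - of_nat n" by (elim nonpos_Ints_cases')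
    then have "z = - of_nat n - 1" by (simp add: eq_diff_eq)
    then have "z = - of_nat (Suc n)" by simp
    with that show False by blast
  qed
  have "\<alpha> + \<beta> + 2 * \<gamma> + 2 \<notin> \<int>\<^sub>\<le>\<^sub>0"
    using assms(6) by (auto elim!: nonpos_Ints_cases')
  then show ?thesis
    using jacobi_Q_product_formula[of A C B x y U P W] assms(7-10) shift[OF assms(4)] shift[OF assms(5)]
    unfolding eqs A_def[symmetric] B_def[symmetric] C_def[symmetric] by blast
qed

end
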